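(* For each positive integer $n$, let $L=L(x)=(1-n^nx)^{-1/n}\in\mathbb Q[[x]]$, let $\Phi_s=\Phi_s(x)\in\mathbb Q[[x]]$ ($s\ge0$) be the coefficients in the expansion $\mathcal F(w,x)\sim e^{\mu(x)w}\sum_{s\ge0}\Phi_s(x)w^{-s}$ as $w\to\infty$, and let $\mathfrak L_k$ be the differential operators on $\mathbb Q[[x]]$ defined in the context. Then: (i) The power series $\Phi_s\in\mathbb Q[[x]]$, $s\ge0$, are determined by the first-order ODEs $$\mathfrak L_1(\Phi_s)+\frac1L\,\mathfrak L_2(\Phi_{s-1})+\frac1{L^2}\,\mathfrak L_3(\Phi_{s-2})+\cdots+\frac1{L^{n-1}}\,\mathfrak L_n(\Phi_{s+1-n})=0,\qquad s\ge0$$ (with the convention $\Phi_r=0$ for $r<0$), together with the initial condition $\Phi_s(0)=\delta_{0,s}$. (ii) For fixed $s$ and $n$, $\Phi_s(x)$ belongs to $L\,\mathbb Q[L]$. (iii) For fixed $s$, $\Phi_s(x)$ belongs to $\mathbb Q(n)[L,L^{-1},L^n]$; the meaning of this is that for each $s\ge0$ there exists $\Psi_s=\Psi_s(a,X,Y,Z)\in\mathbb Q(a)[X,Y,Z]$ (not depending on $n$) such that $$\Phi_s(x)=\Psi_s\big(n,L(x),L(x)^{-1},L(x)^n\big).$$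
   Context: For a positive integer $n$, $$\mathcal F(w,x)=\sum_{d=0}^{\infty}x^d\,\frac{\prod_{r=1}^{nd}(nw+r)}{\prod_{r=1}^{d}\big((w+r)^n-w^n\big)}\in 1+x\,\mathbb Q(w)[[x]].$$ Each coefficient of the power series (in $x$) $\log\mathcal F(w,x)\in\mathbb Q(w)[[x]]$ is a rational function of $w$ which is $O(w)$ as $w\to\infty$. Expanding each coefficient in powers of $w^{-1}$ at $w=\infty$, one gets $\log\mathcal F(w,x)\sim\sum_{j\ge-1}\mu_j(x)w^{-j}$ with $\mu_j\in x\,\mathbb Q[[x]]$; exponentiating, with $\mu=\mu_{-1}$, one gets $\mathcal F(w,x)\sim e^{\mu(x)w}\sum_{s\ge0}\Phi_s(x)w^{-s}$, which defines $\mu\in x\,\mathbb Q[[x]]$ and $\Phi_s\in\mathbb Q[[x]]$. All of these depend on $n$. Polynomials $\mathcal H_{m,j}=\mathcal H_{m,j}(X)\in\mathbb Q[X]$ ($m\ge j\ge0$, depending on $n$) are defined inductively by $$\mathcal H_{0,j}=\delta_{0,j},\qquad \mathcal H_{m,j}=\mathcal H_{m-1,j}+(X-1)\Big(X\frac{d}{dX}+\frac{m-j}{n}\Big)\mathcal H_{m-1,j-1}\quad(m\ge1),$$ with the convention $\mathcal H_{m-1,j-1}=0$ if $j=0$ (and $\mathcal H_{m,j}=0$ for $j>m$). $S_r(n)$ denotes the $r$-th elementary symmetric function of $1,2,\dots,n$, and $D=x\frac{d}{dx}$. The differential operators $\mathfrak L_k$ ($0\le k\le n$) on $\mathbb Q[[x]]$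 are $$\mathfrak L_k=\sum_{i=0}^k\bigg(\binom{n}{i}\mathcal H_{n-i,k-i}(L^n)-(L^n-1)\sum_{r=1}^{k-i}\binom{n-r}{i}\frac{S_r(n)}{n^r}\,\mathcal H_{n-i-r,k-i-r}(L^n)\bigg)D^i .$$ *)

theory Defs
  imports
    "HOL-Computational_Algebra.Computational_Algebra"
    "HOL-Computational_Algebra.Field_as_Ring"
begin

type_synonym ratfun = "rat poly fract"

text \<open>The normal form \<open>quot_of_fract\<close> is a reduced fraction, so regularity at a point and the
  value there do not depend on a chosen representation.\<close>

definition regular_at :: "rat \<Rightarrow> ratfun \<Rightarrow> bool" where
  "regular_at a f \<longleftrightarrow> poly (snd (quot_of_fract f)) a \<noteq> 0"

definition ratfun_eval :: "rat \<Rightarrow> ratfun \<Rightarrow> rat" where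
  "ratfun_eval a f = poly (fst (quot_of_fract f)) a / poly (snd (quot_of_fract f)) a"

text \<open>Expansion at infinity as a Laurent series in \<open>1/w\<close>: the uniformizer \<open>fls_X\<close> stands for
  \<open>1/w\<close>, so \<open>w\<close> is sent to \<open>fls_X_inv\<close>.\<close>

definition expand_at_infinity :: "ratfun \<Rightarrow> rat fls" where
  "expand_at_infinity f =
     poly (map_poly fls_const (fst (quot_of_fract f))) fls_X_inv /
     poly (map_poly fls_const (snd (quot_of_fract f))) fls_X_inv"

text \<open>The power series in \<open>x\<close> formed by the coefficients of \<open>w^(-j)\<close>.\<close>

definition coeff_at_infinity :: "ratfun fps \<Rightarrow> int \<Rightarrow> rat fps" where
  "coeff_at_infinity G j = Abs_fps (\<lambda>d. fls_nth (expand_at_infinity (fps_nth G d)) j)"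

definition w_var :: ratfun where
  "w_var = to_fract [:0, 1:]"

definition hyper_F :: "nat \<Rightarrow> ratfun fps" where
  "hyper_F n = Abs_fps (\<lambda>d. (\<Prod>r=1..n * d. of_nat n * w_var + of_nat r) /
                      (\<Prod>r=1..d. (w_var + of_nat r) ^ n - w_var ^ n))"

text \<open>\<open>fps_ln 1\<close> is the series of \<open>log (1 + X)\<close>, and \<open>hyper_F n\<close> has constant term 1.\<close>

definition log_F :: "nat \<Rightarrow> ratfun fps" where
  "log_F n = fps_compose (fps_ln 1) (hyper_F n - 1)"

definition mu :: "nat \<Rightarrow> rat fps" where
  "mu n = coeff_at_infinity (log_F n) (- 1)"

text \<open>\<open>fps_exp w_var\<close> is the series of \<open>exp (w X)\<close>; substituting \<open>\<mu>(x)\<close> gives \<open>exp (\<mu>(x) w)\<close>, a power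
  series in \<open>x\<close> over \<open>\<rat>(w)\<close>.\<close>

definition exp_mu_w :: "nat \<Rightarrow> ratfun fps" where
  "exp_mu_w n = fps_compose (fps_exp w_var) (Abs_fps (\<lambda>d. to_fract [:fps_nth (mu n) d:]))"

text \<open>The coefficients \<open>\<Phi>\<^sub>s\<close> in \<open>F(w,x) \<sim> exp (\<mu>(x) w) \<cdot> (\<Sum>s. \<Phi>\<^sub>s(x) w^(-s))\<close>, read off from
  \<open>F / exp (\<mu> w)\<close>. As \<open>log F\<close> is \<open>O(w)\<close> coefficientwise, no positive powers of \<open>w\<close> occur in
  the latter.\<close>

definition Phi :: "nat \<Rightarrow> nat \<Rightarrow> rat fps" where
  "Phi n s = coeff_at_infinity (hyper_F n * inverse (exp_mu_w n)) (int s)"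

text \<open>\<open>L(x) = (1 - n^n x)^(-1/n)\<close>, where \<open>fps_binomial a\<close> is the series of \<open>(1 + X)^a\<close>.\<close>

definition L_series :: "nat \<Rightarrow> rat fps" where
  "L_series n = fps_compose (fps_binomial (- 1 / of_nat n)) (fps_const (- (of_nat n ^ n)) * fps_X)"

text \<open>The recursion yields 0 for \<open>j > m\<close> without a separate clause.\<close>

fun H_poly :: "nat \<Rightarrow> nat \<Rightarrow> nat \<Rightarrow> rat poly" where
  "H_poly n 0 j = (if j = 0 then 1 else 0)"
| "H_poly n (Suc m) 0 = H_poly n m 0"
| "H_poly n (Suc m) (Suc j) =
     H_poly n m (Suc j) +
     ([:0, 1:] - 1) *
       ([:0, 1:] * pderiv (H_poly n m j) +
        smult ((of_nat (Suc m) - of_nat (Suc j)) / of_nat n) (H_poly n m j))"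

definition S_sym :: "nat \<Rightarrow> nat \<Rightarrow> nat" where
  "S_sym r n = (\<Sum>A | A \<subseteq> {1..n} \<and> card A = r. \<Prod>A)"

definition D_op :: "rat fps \<Rightarrow> rat fps" where
  "D_op f = fps_X * fps_deriv f"

definition poly_fps :: "rat poly \<Rightarrow> rat fps \<Rightarrow> rat fps" where
  "poly_fps p f = poly (map_poly fps_const p) f"

definition Lop :: "nat \<Rightarrow> nat \<Rightarrow> rat fps \<Rightarrow> rat fps" where
  "Lop n k f =
     (\<Sum>i=0..k.
        (of_nat (n choose i) * poly_fps (H_poly n (n - i) (k - i)) (L_series n ^ n) -
         (L_series n ^ n - 1) *
           (\<Sum>r=1..k - i.
              fps_const (of_nat ((n - r) choose i) * (of_nat (S_sym r n) / of_nat n ^ r)) *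
              poly_fps (H_poly n (n - i - r) (k - i - r)) (L_series n ^ n))) *
        (D_op ^^ i) f)"

text \<open>The \<open>s\<close>-th equation, with the summand for \<open>k\<close> involving \<open>\<Phi>\<close> at index \<open>s + 1 - k\<close>, which is
  zero by convention when negative.\<close>

definition satisfies_ODE :: "nat \<Rightarrow> (nat \<Rightarrow> rat fps) \<Rightarrow> nat \<Rightarrow> bool" where
  "satisfies_ODE n f s \<longleftrightarrow>
     (\<Sum>k=1..n. inverse (L_series n) ^ (k - 1) *
        Lop n k (if k \<le> s + 1 then f (s + 1 - k) else 0)) = 0"

text \<open>Elements of \<open>\<rat>(a)[X,Y,Z]\<close> are represented as \<open>((\<rat>(a)[X])[Y])[Z]\<close>, the outermost variable
  being \<open>Z\<close>.\<close>

type_synonym ratfun_poly3 = "ratfun poly poly poly"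

definition regular3_at :: "rat \<Rightarrow> ratfun_poly3 \<Rightarrow> bool" where
  "regular3_at a P \<longleftrightarrow> (\<forall>i j k. regular_at a (coeff (coeff (coeff P k) j) i))"

definition eval3 :: "ratfun_poly3 \<Rightarrow> rat \<Rightarrow> rat fps \<Rightarrow> rat fps \<Rightarrow> rat fps \<Rightarrow> rat fps" where
  "eval3 P a x y z =
     poly (map_poly (\<lambda>q.
       poly (map_poly (\<lambda>p.
         poly (map_poly (\<lambda>c. fps_const (ratfun_eval a c)) p) x) q) y) P) z"


end

theory Submission
  imports Defs
begin

text \<open>With \<open>D = x d/dx\<close> and \<open>D\<^sub>w = D + w\<close>, the series \<open>F = hyper_F n\<close> is the unique solution with constant
  term 1 of \<open>(D\<^sub>w^n - w^n - x \<Prod>\<^sub>j (n D\<^sub>w + j)) F = 0\<close>. Conjugating by \<open>exp (\<mu> w)\<close> with \<open>1 + D \<mu> = L\<close> replaces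
  \<open>D\<^sub>w\<close> by \<open>D + L w\<close>; expanding the powers of \<open>D + L w\<close> by means of the polynomials \<open>H\<close> turns the equation
  into \<open>\<Sum>\<^sub>k (L w)^(n-k) \<LL>\<^sub>k = 0\<close>. Hence every solution of the system of ODEs, normalized at \<open>x = 0\<close>, yields
  \<open>F\<close>, so it is \<open>\<Phi>\<close>.

  A solution is constructed by the homogeneous ansatz \<open>L^(1-s) f\<^sub>s(L^n)\<close>, for which the ODEs become the recursion
  \<open>(n X d/dX - s) f\<^sub>s = \<dots>\<close> for polynomials \<open>f\<^sub>s\<close> with coefficients in \<open>\<rat>(n)\<close>. Division by \<open>n b - s\<close> could
  create a pole at a positive integer \<open>n\<close>. It does not: modulo \<open>L^n\<close> the operator is conjugate to
  \<open>(1 - \<partial>/n)^n - 1\<close> acting on polynomials in \<open>L w\<close>, so the right-hand side has no terms \<open>X^b\<close> with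
  \<open>n b \<le> s\<close>. The initial condition is then achieved by multiplying with a series in \<open>1/w\<close>.\<close>

section \<open>The operator expansion\<close>

text \<open>Multiplying the equation for \<open>F\<close> by \<open>L^n\<close> trades
  \<open>x\<close> for \<open>X = L^n\<close>, since \<open>n^n x L^n = L^n - 1\<close>. The ring
  generated by \<open>X\<close> and \<open>y = L w\<close> is closed under \<open>D\<close>, with
  \<open>D X = X (X - 1)\<close> and \<open>D y = y (X - 1) / n\<close>. Only these rules enter the
  expansion, so it is done once in an abstract ring and read twice: for the true \<open>L\<close>
  and \<open>w\<close>, and for \<open>X = 0\<close> with a polynomial variable \<open>y\<close>. In
  the second reading the factor \<open>D + y + j/n\<close> sends \<open>y^j h\<close> to
  \<open>y^(j+1) (1 - \<partial>/n) h\<close>, which is the origin of the conjugation mentioned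
  above.

  Rational dependence on \<open>n\<close> meets a further obstacle: the coefficients of
  \<open>\<LL>\<^sub>k\<close> contain \<open>H_poly n m j\<close> with
  \<open>m = n - i - r\<close>, so the number of recursion steps grows with \<open>n\<close>. For
  fixed \<open>j\<close> the dependence on \<open>m\<close> is shown to be polynomial, by summing
  powers, before \<open>m\<close> is specialized. Moreover, where \<open>n\<close> divides
  \<open>s > 0\<close>, the polynomial \<open>f\<^sub>s\<close> is determined only up to a multiple
  of \<open>X^(s/n)\<close>; the recursion is solved for all \<open>n\<close> at once, and the
  rational function of \<open>n\<close> supplies the choice.\<close>

lemma S_sym_0 [simp]: "S_sym 0 n = 1"
proof -
  have "{A. A \<subseteq> {1..n} \<and> card A = 0} = {{}}"
    by (auto simp: card_eq_0_iff finite_subset[of _ "{1..n}"])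
  then show ?thesis by (simp add: S_sym_def)
qed

lemma S_sym_eq_0: "n < r \<Longrightarrow> S_sym r n = 0"
proof -
  assume "n < r"
  have "{A. A \<subseteq> {1..n} \<and> card A = r} = {}"
    using \<open>n < r\<close> by (auto dest!: card_mono[OF finite_atLeastAtMost])
  then show ?thesis by (simp only: S_sym_def sum.empty)
qed

text \<open>Subsets of \<open>{1..Suc n}\<close> are split by membership of \<open>Suc n\<close>.
  Appending one more factor to \<open>Dy_prod\<close> changes its coefficients in the same
  way.\<close>

lemma S_sym_Suc: "S_sym (Suc r) (Suc n) = S_sym (Suc r) n + Suc n * S_sym r n"
proof -
  let ?P = "{A. A \<subseteq> {1..n} \<and> card A = Suc r}" and ?Q = "{A. A \<subseteq> {1..n} \<and> card A = r}"
  have fin: "finite ?P" "finite ?Q" by simp_all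
  have fA: "finite A" if "A \<subseteq> {1..n}" for A using that finite_subset by blast
  have ni: "Suc n \<notin> A" if "A \<subseteq> {1..n}" for A using that by auto
  have eq: "{A. A \<subseteq> {1..Suc n} \<and> card A = Suc r} = ?P \<union> insert (Suc n) ` ?Q"
  proof (intro equalityI subsetI)
    fix A assume "A \<in> {A. A \<subseteq> {1..Suc n} \<and> card A = Suc r}"
    then have A: "A \<subseteq> insert (Suc n) {1..n}" "card A = Suc r" by (simp_all add: atLeastAtMostSuc_conv)
    then have finA: "finite A" using finite_subset by blast
    show "A \<in> ?P \<union> insert (Suc n) ` ?Q"
    proof (cases "Suc n \<in> A")
      case False
      then show ?thesis using A by blast
    next
      case True
      then have "A - {Suc n} \<subseteq> {1..n}" "card (A - {Suc n}) = r"
        using A finA by (blast, simp)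
      moreover have "A = insert (Suc n) (A - {Suc n})" using True by blast
      ultimately show ?thesis by blast
    qed
  next
    fix A assume "A \<in> ?P \<union> insert (Suc n) ` ?Q"
    then consider "A \<in> ?P" | B where "A = insert (Suc n) B" "B \<in> ?Q" by blast
    then show "A \<in> {A. A \<subseteq> {1..Suc n} \<and> card A = Suc r}"
    proof cases
      case 2
      then show ?thesis using fA[of B] ni[of B] by (simp add: atLeastAtMostSuc_conv) blast
    qed (simp add: atLeastAtMostSuc_conv, blast)
  qed
  have disj: "?P \<inter> insert (Suc n) ` ?Q = {}" using ni by blast
  have inj: "inj_on (insert (Suc n)) ?Q"
  proof (rule inj_onI)
    fix A B assume "A \<in> ?Q" "B \<in> ?Q" "insert (Suc n) A = insert (Suc n) B"
    then show "A = B" using ni insert_ident[of "Suc n" A B] by blast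
  qed
  have "sum Prod (insert (Suc n) ` ?Q) = (\<Sum>A\<in>?Q. Suc n * \<Prod>A)"
    unfolding sum.reindex[OF inj] comp_def
  proof (rule sum.cong[OF refl])
    fix A assume "A \<in> ?Q"
    then show "\<Prod>(insert (Suc n) A) = Suc n * \<Prod>A" using fA ni by simp
  qed
  then show ?thesis
    unfolding S_sym_def eq sum.union_disjoint[OF fin(1) finite_imageI[OF fin(2)] disj]
    by (simp only: sum_distrib_left)
qed

lemma H_poly_0 [simp]: "H_poly n m 0 = 1"
  by (induction m) auto

lemma H_poly_eq_0: "m < j \<Longrightarrow> H_poly n m j = 0"
proof (induction m arbitrary: j)
  case (Suc m)
  then show ?case by (cases j) auto
qed auto

text \<open>The recursion starts from 0 and adds only multiples of \<open>X - 1\<close>. This is one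
  source of the common factor \<open>X - 1\<close> that is later divided out of the
  equations.\<close>

lemma H_poly_dvd: "[:-1, 1:] dvd H_poly n m (Suc j)"
proof (induction m)
  case (Suc m)
  have "[:0, 1:] - 1 = [:-1, 1 :: rat:]" by (simp add: one_pCons)
  with Suc show ?case by (simp only: H_poly.simps dvd_add dvd_triv_left)
qed auto

lemma sum_atMost_diff_reindex:
  fixes G :: "nat \<Rightarrow> nat \<Rightarrow> 'a::comm_monoid_add"
  shows "(\<Sum>i\<le>m. \<Sum>j\<le>m - i. G i j) = (\<Sum>k\<le>m. \<Sum>i\<le>k. G i (k - i))"
proof -
  have "(\<Sum>i\<le>m. \<Sum>j\<le>m - i. G i j) = (\<Sum>(i, j)\<in>{(i, j). i + j \<le> m}. G i j)"
    by (simp add: sum.Sigma, rule sum.cong) auto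
  also have "\<dots> = (\<Sum>k\<le>m. \<Sum>i\<le>k. G i (k - i))"
    by (rule sum.triangle_reindex_eq)
  finally show ?thesis .
qed

section \<open>Evaluation of rational polynomials, and rings with a derivation\<close>

locale rat_hom =
  fixes \<iota> :: "rat \<Rightarrow> 'a::comm_ring_1" and X :: 'a
  assumes \<iota>_1: "\<iota> 1 = 1" and \<iota>_add: "\<iota> (a + b) = \<iota> a + \<iota> b" and \<iota>_mult: "\<iota> (a * b) = \<iota> a * \<iota> b"
begin

lemma \<iota>_0 [simp]: "\<iota> 0 = 0"
  using \<iota>_add[of 0 0] by simp

lemma \<iota>_minus: "\<iota> (- a) = - \<iota> a"
  using \<iota>_add[of a "- a"] by (simp add: eq_neg_iff_add_eq_0 add.commute)

lemma \<iota>_of_nat: "\<iota> (of_nat k) = of_nat k"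
  by (induction k) (auto simp: \<iota>_1 \<iota>_add)

definition ev :: "rat poly \<Rightarrow> 'a" where "ev p = poly (map_poly \<iota> p) X"

lemma ev_0 [simp]: "ev 0 = 0" by (simp add: ev_def)

lemma ev_pCons: "ev (pCons c p) = \<iota> c + X * ev p"
  by (cases "c = 0 \<and> p = 0") (auto simp: ev_def map_poly_pCons)

lemma ev_1 [simp]: "ev 1 = 1"
  by (simp add: one_pCons ev_pCons \<iota>_1)

lemma ev_add: "ev (p + q) = ev p + ev q"
proof (induction p q rule: poly_induct2)
  case (pCons a p b q)
  then show ?case by (simp add: ev_pCons \<iota>_add algebra_simps)
qed simp

lemma ev_smult: "ev (smult c p) = \<iota> c * ev p"
  by (induction p) (auto simp: ev_pCons \<iota>_mult algebra_simps)

lemma ev_diff: "ev (p - q) = ev p - ev q"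
  using ev_add[of "p - q" q] by simp

lemma ev_mult: "ev (p * q) = ev p * ev q"
proof (induction p)
  case (pCons a p)
  then show ?case by (simp add: ev_pCons ev_add ev_smult algebra_simps)
qed simp

lemma ev_X: "ev [:0, 1:] = X"
  by (simp add: ev_pCons \<iota>_1)

lemma ev_sum: "ev (sum f A) = (\<Sum>a\<in>A. ev (f a))"
  by (induction A rule: infinite_finite_induct) (auto simp: ev_add)

lemma ev_monom: "ev (monom c k) = \<iota> c * X ^ k"
  by (induction k) (simp_all add: monom_Suc monom_0 ev_pCons mult_ac)

lemma ev_altdef:
  assumes "degree p \<le> B"
  shows "ev p = (\<Sum>b\<le>B. \<iota> (coeff p b) * X ^ b)"
  using arg_cong[OF poly_as_sum_of_monoms'[OF assms], of ev] by (simp add: ev_sum ev_monom)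

lemma ev_of_nat: "ev (of_nat c) = of_nat c"
  by (simp add: of_nat_poly ev_pCons \<iota>_of_nat)

end

text \<open>Models \<open>X = L^n\<close> and \<open>y = L w\<close>, but keeps \<open>X\<close> and
  \<open>y\<close> as independent parameters, so that \<open>X = 0\<close> is an admissible
  specialization.\<close>

locale derivation_algebra = rat_hom \<iota> X for \<iota> :: "rat \<Rightarrow> 'a::comm_ring_1" and X :: 'a +
  fixes D :: "'a \<Rightarrow> 'a" and y :: 'a and n :: nat
  assumes D_add: "D (g + h) = D g + D h" and D_mult: "D (g * h) = D g * h + g * D h"
    and D_\<iota>: "D (\<iota> a) = 0"
    and D_X: "D X = X * (X - 1)" and D_y: "D y = \<iota> (1 / of_nat n) * y * (X - 1)"
begin

lemma D_0 [simp]: "D 0 = 0"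
  using D_\<iota>[of 0] by simp

lemma D_1 [simp]: "D 1 = 0"
  using D_\<iota>[of 1] by (simp add: \<iota>_1)

lemma D_scale: "D (\<iota> c * g) = \<iota> c * D g"
  by (simp add: D_mult D_\<iota>)

lemma D_of_nat_mult: "D (of_nat c * g) = of_nat c * D g"
  using D_scale[of "of_nat c"] by (simp add: \<iota>_of_nat)

lemma D_ev: "D (ev p) = X * (X - 1) * ev (pderiv p)"
proof (induction p)
  case (pCons a p)
  then show ?case
    by (simp add: ev_pCons pderiv_pCons D_add D_mult D_\<iota> D_X ev_add) (simp add: algebra_simps)
qed simp

lemma D_y_power: "D (y ^ k) = \<iota> (of_nat k / of_nat n) * (X - 1) * y ^ k"
proof (induction k)
  case (Suc k)
  have "\<iota> (of_nat (Suc k) / of_nat n) = \<iota> (1 / of_nat n) + \<iota> (of_nat k / of_nat n)"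
    by (simp flip: \<iota>_add add: add_divide_distrib)
  with Suc show ?case by (simp add: D_mult D_y) (simp add: algebra_simps)
qed simp

text \<open>By \<open>D_ev\<close> the term \<open>(X - 1) X d/dX\<close> of the recursion is the
  action of \<open>D\<close>, so the recursion can be stated through the derivation alone.\<close>

lemma ev_H_Suc:
  "ev (H_poly n (Suc m) (Suc j)) =
     ev (H_poly n m (Suc j)) + D (ev (H_poly n m j)) +
     \<iota> ((of_nat m - of_nat j) / of_nat n) * (X - 1) * ev (H_poly n m j)"
  by (simp add: ev_add ev_mult ev_diff ev_X ev_smult D_ev del: mult_pCons_left mult_pCons_right)
     (simp add: algebra_simps)

definition Dy :: "'a \<Rightarrow> 'a" where "Dy g = D g + y * g"

lemma Dy_add: "Dy (g + h) = Dy g + Dy h"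
  by (simp add: Dy_def D_add algebra_simps)

lemma Dy_0 [simp]: "Dy 0 = 0"
  by (simp add: Dy_def)

lemma Dy_sum: "Dy (sum f A) = (\<Sum>a\<in>A. Dy (f a))"
  by (induction A rule: infinite_finite_induct) (auto simp: Dy_add)

lemma Dy_scale: "Dy (\<iota> c * g) = \<iota> c * Dy g"
  by (simp add: Dy_def D_scale distrib_left mult.left_commute)

text \<open>This is what the recursion for \<open>H_poly\<close> encodes: multiplication by
  \<open>y\<close> raises the degree in \<open>y\<close> and keeps \<open>j\<close>, while
  \<open>D\<close> keeps the degree and raises \<open>j\<close>, the derivative of
  \<open>y^(m-j)\<close> giving the factor \<open>(m - j)/n\<close>.\<close>

lemma Dy_power_1: "(Dy ^^ m) 1 = (\<Sum>j\<le>m. ev (H_poly n m j) * y ^ (m - j))"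
proof (induction m)
  case (Suc m)
  define h where "h j = ev (H_poly n m j)" for j
  define e where "e j = (D (h j) + \<iota> ((of_nat m - of_nat j) / of_nat n) * (X - 1) * h j) * y ^ (m - j)" for j
  have h0: "h (Suc m) = 0" by (simp add: h_def H_poly_eq_0)
  have "(Dy ^^ Suc m) 1 = (\<Sum>j\<le>m. Dy (h j * y ^ (m - j)))"
    by (simp add: Suc Dy_sum h_def)
  also have "\<dots> = (\<Sum>j\<le>m. e j + h j * y ^ (Suc m - j))"
  proof (rule sum.cong)
    fix j assume "j \<in> {..m}"
    then have "j \<le> m" by simp
    then have 1: "of_nat (m - j) = (of_nat m - of_nat j :: rat)" by (simp add: of_nat_diff)
    show "Dy (h j * y ^ (m - j)) = e j + h j * y ^ (Suc m - j)"
      using \<open>j \<le> m\<close> by (simp add: Dy_def D_mult D_y_power e_def 1 Suc_diff_le algebra_simps)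
  qed simp
  also have "\<dots> = (\<Sum>j\<le>m. e j) + (\<Sum>j\<le>m. h j * y ^ (Suc m - j))"
    by (simp add: sum.distrib)
  also have "(\<Sum>j\<le>m. h j * y ^ (Suc m - j)) = (\<Sum>j\<le>Suc m. h j * y ^ (Suc m - j))"
    by (simp add: h0)
  also have "\<dots> = h 0 * y ^ Suc m + (\<Sum>j\<le>m. h (Suc j) * y ^ (m - j))"
    by (subst sum.atMost_Suc_shift) simp
  also have "(\<Sum>j\<le>m. e j) + (h 0 * y ^ Suc m + (\<Sum>j\<le>m. h (Suc j) * y ^ (m - j))) =
      h 0 * y ^ Suc m + (\<Sum>j\<le>m. (h (Suc j) * y ^ (m - j) + e j))"
    by (simp add: sum.distrib)
  also have "\<dots> = (\<Sum>j\<le>Suc m. ev (H_poly n (Suc m) j) * y ^ (Suc m - j))"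
    by (subst sum.atMost_Suc_shift) (simp only: ev_H_Suc, simp add: h_def e_def algebra_simps)
  finally show ?case .
qed simp

text \<open>A Leibniz rule: \<open>Dy\<close> of a product \<open>u h\<close> is \<open>Dy u\<close>
  times \<open>h\<close> plus \<open>u\<close> times \<open>D h\<close>. The two summands come from
  commuting actions, so powers expand binomially, starting from \<open>u = 1\<close>.\<close>

lemma Dy_power:
  "(Dy ^^ m) g = (\<Sum>i\<le>m. of_nat (m choose i) * (Dy ^^ (m - i)) 1 * (D ^^ i) g)"
proof (induction m)
  case (Suc m)
  define u where "u i = (Dy ^^ i) 1" for i
  have Dyu: "Dy (u i * h) = u (Suc i) * h + u i * D h" for i h
    by (simp add: u_def Dy_def D_mult algebra_simps)
  have "(Dy ^^ Suc m) g = (\<Sum>i\<le>m. Dy (u (m - i) * (of_nat (m choose i) * (D ^^ i) g)))"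
    by (simp add: Suc Dy_sum u_def algebra_simps)
  also have "\<dots> = (\<Sum>i\<le>m. of_nat (m choose i) * u (Suc m - i) * (D ^^ i) g) +
                  (\<Sum>i\<le>m. of_nat (m choose i) * u (m - i) * (D ^^ Suc i) g)"
    unfolding Dyu sum.distrib D_of_nat_mult
    by (intro arg_cong2[of _ _ _ _ "(+)"] sum.cong) (auto simp: Suc_diff_le mult_ac)
  also have "(\<Sum>i\<le>m. of_nat (m choose i) * u (Suc m - i) * (D ^^ i) g) =
      (\<Sum>i\<le>Suc m. of_nat (m choose i) * u (Suc m - i) * (D ^^ i) g)"
    by (simp add: binomial_eq_0)
  also have "\<dots> = u (Suc m) * g + (\<Sum>i\<le>m. of_nat (m choose Suc i) * u (m - i) * (D ^^ Suc i) g)"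
    by (subst sum.atMost_Suc_shift) simp
  also have "\<dots> + (\<Sum>i\<le>m. of_nat (m choose i) * u (m - i) * (D ^^ Suc i) g) =
      u (Suc m) * g + (\<Sum>i\<le>m. of_nat (Suc m choose Suc i) * u (m - i) * (D ^^ Suc i) g)"
    by (simp add: sum.distrib[symmetric] algebra_simps del: funpow.simps)
  also have "\<dots> = (\<Sum>i\<le>Suc m. of_nat (Suc m choose i) * u (Suc m - i) * (D ^^ i) g)"
    by (subst sum.atMost_Suc_shift) (simp del: funpow.simps)
  finally show ?case by (simp only: u_def)
qed simp

lemma Dy_power_expand:
  "(Dy ^^ m) g =
     (\<Sum>k\<le>m. y ^ (m - k) *
        (\<Sum>i\<le>k. of_nat (m choose i) * ev (H_poly n (m - i) (k - i)) * (D ^^ i) g))"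
proof -
  have "(Dy ^^ m) g = (\<Sum>i\<le>m. \<Sum>j\<le>m - i.
          y ^ (m - i - j) * (of_nat (m choose i) * ev (H_poly n (m - i) j) * (D ^^ i) g))"
    unfolding Dy_power[of m g] Dy_power_1
    by (simp add: sum_distrib_left sum_distrib_right algebra_simps)
  also have "\<dots> = (\<Sum>k\<le>m. \<Sum>i\<le>k.
          y ^ (m - i - (k - i)) * (of_nat (m choose i) * ev (H_poly n (m - i) (k - i)) * (D ^^ i) g))"
    by (rule sum_atMost_diff_reindex)
  finally show ?thesis by (simp add: sum_distrib_left)
qed

text \<open>The product of the factors \<open>D + y + j/n\<close> for \<open>j = 1..N\<close>. The
  denominator stays \<open>n\<close> while \<open>N\<close> grows, which leaves \<open>N\<close>
  free for induction.\<close>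

fun Dy_prod :: "nat \<Rightarrow> 'a \<Rightarrow> 'a" where
  "Dy_prod 0 g = g"
| "Dy_prod (Suc N) g = Dy (Dy_prod N g) + \<iota> (of_nat (Suc N) / of_nat n) * Dy_prod N g"

lemma Dy_prod_expand:
  "Dy_prod N g = (\<Sum>r\<le>N. \<iota> (of_nat (S_sym r N) / of_nat n ^ r) * (Dy ^^ (N - r)) g)"
proof (induction N)
  case (Suc N)
  define c where "c r = \<iota> (of_nat (S_sym r N) / of_nat n ^ r)" for r
  define v where "v i = (Dy ^^ i) g" for i
  have c0: "c (Suc N) = 0" by (simp add: c_def S_sym_eq_0)
  have "Dy_prod (Suc N) g = (\<Sum>r\<le>N. c r * v (Suc N - r)) + (\<Sum>r\<le>N. \<iota> (of_nat (Suc N) / of_nat n) * c r * v (N - r))"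
    by (simp add: Suc Dy_sum Dy_scale sum_distrib_left c_def v_def Suc_diff_le mult.assoc)
  also have "(\<Sum>r\<le>N. c r * v (Suc N - r)) = (\<Sum>r\<le>Suc N. c r * v (Suc N - r))"
    by (simp add: c0)
  also have "\<dots> = c 0 * v (Suc N) + (\<Sum>r\<le>N. c (Suc r) * v (N - r))"
    by (subst sum.atMost_Suc_shift) simp
  also have "\<dots> + (\<Sum>r\<le>N. \<iota> (of_nat (Suc N) / of_nat n) * c r * v (N - r)) =
      c 0 * v (Suc N) + (\<Sum>r\<le>N. (c (Suc r) + \<iota> (of_nat (Suc N) / of_nat n) * c r) * v (N - r))"
    by (simp add: sum.distrib[symmetric] algebra_simps)
  also have "\<dots> = (\<Sum>r\<le>Suc N. \<iota> (of_nat (S_sym r (Suc N)) / of_nat n ^ r) * v (Suc N - r))"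
  proof -
    have "c (Suc r) + \<iota> (of_nat (Suc N) / of_nat n) * c r = \<iota> (of_nat (S_sym (Suc r) (Suc N)) / of_nat n ^ Suc r)" for r
      unfolding c_def \<iota>_add[symmetric] \<iota>_mult[symmetric] S_sym_Suc by (rule arg_cong[of _ _ \<iota>]) (simp add: add_divide_distrib ring_distribs)
    then show ?thesis by (subst sum.atMost_Suc_shift) (simp add: c_def)
  qed
  finally show ?case by (simp only: v_def)
qed (simp add: \<iota>_1)

end

text \<open>The bracket in front of \<open>D^i\<close> in the operator of index \<open>k\<close>,
  kept as a polynomial in \<open>X\<close> until \<open>L^n\<close> is substituted.\<close>

definition A_coeff :: "nat \<Rightarrow> nat \<Rightarrow> nat \<Rightarrow> rat poly" where
  "A_coeff n k i =
     of_nat (n choose i) * H_poly n (n - i) (k - i) -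
     [:-1, 1:] * (\<Sum>r=1..k - i. smult (of_nat ((n - r) choose i) * (of_nat (S_sym r n) / of_nat n ^ r))
        (H_poly n (n - i - r) (k - i - r)))"

context derivation_algebra
begin

text \<open>The index \<open>k\<close> counts the drop in the power of \<open>y\<close>. For
  \<open>k = 0\<close> the only contribution is \<open>y^n g\<close>, which the left-hand side
  subtracts, so the sum starts at 1.\<close>

theorem operator_expand:
  "(Dy ^^ n) g - y ^ n * g - (X - 1) * (\<Sum>r=1..n. \<iota> (of_nat (S_sym r n) / of_nat n ^ r) * (Dy ^^ (n - r)) g)
   = (\<Sum>k=1..n. y ^ (n - k) * (\<Sum>i\<le>k. ev (A_coeff n k i) * (D ^^ i) g))"
proof -
  define s where "s r = \<iota> (of_nat (S_sym r n) / of_nat n ^ r)" for r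
  define B where "B k i r = y ^ (n - k) * (s r * of_nat ((n - r) choose i) * ev (H_poly n (n - i - r) (k - i - r)) * (D ^^ i) g)"
    for k i r
  have 1: "(Dy ^^ n) g - y ^ n * g =
     (\<Sum>k=1..n. y ^ (n - k) * (\<Sum>i\<le>k. of_nat (n choose i) * ev (H_poly n (n - i) (k - i)) * (D ^^ i) g))"
    unfolding Dy_power_expand[of n g] atMost_atLeast0
    by (subst sum.atLeast_Suc_atMost) simp_all
  \<comment> \<open>A term of index \<open>l\<close> in the expansion of
    \<open>Dy ^^ (n - r)\<close> carries \<open>y^(n - r - l)\<close>, hence belongs to
    \<open>k = l + r\<close>.\<close>
  have "s r * (Dy ^^ (n - r)) g = (\<Sum>k=r..n. \<Sum>i\<le>k - r. B k i r)" if "r \<le> n" for r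
  proof -
    have "s r * (Dy ^^ (n - r)) g = (\<Sum>k\<le>n - r. \<Sum>i\<le>k. B (k + r) i r)"
      unfolding Dy_power_expand[of "n - r" g] B_def sum_distrib_left
      by (intro sum.cong refl) (simp add: algebra_simps)
    also have "\<dots> = (\<Sum>k=0+r..(n - r)+r. \<Sum>i\<le>k - r. B k i r)"
      unfolding atMost_atLeast0 by (subst sum.shift_bounds_cl_nat_ivl) simp
    finally show ?thesis using that by simp
  qed
  then have "(\<Sum>r=1..n. s r * (Dy ^^ (n - r)) g) = (\<Sum>r=1..n. \<Sum>k=r..n. \<Sum>i\<le>k - r. B k i r)"
    by simp
  also have "\<dots> = (\<Sum>k=1..n. \<Sum>r=1..k. \<Sum>i\<le>k - r. B k i r)"
    by (subst (1 2) sum.Sigma, simp, simp, simp, simp)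
       (rule sum.reindex_bij_witness[of _ "\<lambda>(k, r). (r, k)" "\<lambda>(r, k). (k, r)"], auto)
  also have "\<dots> = (\<Sum>k=1..n. \<Sum>i\<le>k. \<Sum>r=1..k - i. B k i r)"
  proof (rule sum.cong[OF refl])
    fix k
    show "(\<Sum>r=1..k. \<Sum>i\<le>k - r. B k i r) = (\<Sum>i\<le>k. \<Sum>r=1..k - i. B k i r)"
      by (subst (1 2) sum.Sigma, simp, simp, simp, simp)
       (rule sum.reindex_bij_witness[of _ "\<lambda>(k, r). (r, k)" "\<lambda>(r, k). (k, r)"], auto)
  qed
  finally have 2: "(\<Sum>r=1..n. s r * (Dy ^^ (n - r)) g) = (\<Sum>k=1..n. \<Sum>i\<le>k. \<Sum>r=1..k - i. B k i r)" .
  have 3: "ev (A_coeff n k i) = of_nat (n choose i) * ev (H_poly n (n - i) (k - i)) - (X - 1) *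
      (\<Sum>r=1..k - i. s r * of_nat ((n - r) choose i) * ev (H_poly n (n - i - r) (k - i - r)))" for k i
  proof -
    have "ev [:-1, 1:] = X - 1" by (simp add: ev_pCons \<iota>_1 \<iota>_minus)
    moreover have "\<iota> (of_nat c * a) = \<iota> a * of_nat c" for c a
      by (simp add: \<iota>_mult \<iota>_of_nat mult.commute)
    ultimately show ?thesis
      by (simp only: A_coeff_def ev_diff ev_mult ev_sum ev_smult s_def ev_of_nat)
  qed
  show ?thesis
    unfolding 1 2[unfolded s_def] 3 B_def
    by (simp add: sum_distrib_left sum_distrib_right sum_subtractf left_diff_distrib right_diff_distrib mult_ac)
qed

end

section \<open>Rational dependence on \<open>n\<close>\<close>

named_theorems rational_intros

text \<open>The denominator must not vanish at any positive integer, as the final coefficients are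
  evaluated at all of them. The class is closed under sums and products but not under quotients, so
  divisions need arguments of their own.\<close>

definition rational_at_pos :: "(nat \<Rightarrow> rat) \<Rightarrow> bool" where
  "rational_at_pos c \<longleftrightarrow>
     (\<exists>p q. \<forall>n>0. poly q (of_nat n) \<noteq> 0 \<and> c n = poly p (of_nat n) / poly q (of_nat n))"

lemma rational_at_posI:
  assumes "\<And>n. n > 0 \<Longrightarrow> poly q (of_nat n) \<noteq> 0"
    and "\<And>n. n > 0 \<Longrightarrow> c n = poly p (of_nat n) / poly q (of_nat n)"
  shows "rational_at_pos c"
  unfolding rational_at_pos_def using assms by (intro exI[of _ p] exI[of _ q]) simp

lemma rational_at_posE:
  assumes "rational_at_pos c"
  obtains p q where "\<And>n. n > 0 \<Longrightarrow> poly q (of_nat n) \<noteq> 0" "\<And>n. n > 0 \<Longrightarrow> c n = poly p (of_nat n) / poly q (of_nat n)"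
proof -
  obtain p q where "\<forall>n>0. poly q (of_nat n) \<noteq> 0 \<and> c n = poly p (of_nat n) / poly q (of_nat n)"
    using assms unfolding rational_at_pos_def by (elim exE)
  then show ?thesis by (intro that[of q p]) simp_all
qed

lemma rational_at_pos_cong:
  assumes "rational_at_pos c" and eq: "\<And>n. n > 0 \<Longrightarrow> c n = d n"
  shows "rational_at_pos d"
proof -
  obtain p q where pq: "\<And>n. n > 0 \<Longrightarrow> poly q (of_nat n) \<noteq> 0" "\<And>n. n > 0 \<Longrightarrow> c n = poly p (of_nat n) / poly q (of_nat n)"
    using assms(1) by (rule rational_at_posE) blast
  show ?thesis
    by (rule rational_at_posI[of q _ p]) (simp_all add: pq flip: eq)
qed

lemma rational_at_pos_poly: "rational_at_pos (\<lambda>n. poly p (of_nat n))"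
  by (rule rational_at_posI[of 1 _ p]) simp_all

lemma rational_at_pos_const [rational_intros]: "rational_at_pos (\<lambda>n. c)"
  using rational_at_pos_poly[of "[:c:]"] by simp

lemma rational_at_pos_of_nat [rational_intros]: "rational_at_pos of_nat"
  using rational_at_pos_poly[of "[:0, 1:]"] by simp

lemma rational_at_pos_inverse [rational_intros]: "rational_at_pos (\<lambda>n. 1 / of_nat n)"
  by (rule rational_at_posI[of "[:0, 1:]" _ 1]) simp_all

lemma rational_at_pos_add [rational_intros]:
  assumes "rational_at_pos c" "rational_at_pos d"
  shows "rational_at_pos (\<lambda>n. c n + d n)"
proof -
  obtain p q where 1: "\<And>n. n > 0 \<Longrightarrow> poly q (of_nat n) \<noteq> 0" "\<And>n. n > 0 \<Longrightarrow> c n = poly p (of_nat n) / poly q (of_nat n)"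
    using assms(1) by (rule rational_at_posE) blast
  obtain p' q' where 2: "\<And>n. n > 0 \<Longrightarrow> poly q' (of_nat n) \<noteq> 0" "\<And>n. n > 0 \<Longrightarrow> d n = poly p' (of_nat n) / poly q' (of_nat n)"
    using assms(2) by (rule rational_at_posE) blast
  show ?thesis
  proof (rule rational_at_posI[of "q * q'" _ "p * q' + p' * q"])
    fix n :: nat assume n: "n > 0"
    show "poly (q * q') (of_nat n) \<noteq> 0" using 1(1)[OF n] 2(1)[OF n] by simp
    show "c n + d n = poly (p * q' + p' * q) (of_nat n) / poly (q * q') (of_nat n)"
      unfolding 1(2)[OF n] 2(2)[OF n] using 1(1)[OF n] 2(1)[OF n] by (simp add: add_frac_eq)
  qed
qed

lemma rational_at_pos_mult [rational_intros]:
  assumes "rational_at_pos c" "rational_at_pos d"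
  shows "rational_at_pos (\<lambda>n. c n * d n)"
proof -
  obtain p q where 1: "\<And>n. n > 0 \<Longrightarrow> poly q (of_nat n) \<noteq> 0" "\<And>n. n > 0 \<Longrightarrow> c n = poly p (of_nat n) / poly q (of_nat n)"
    using assms(1) by (rule rational_at_posE) blast
  obtain p' q' where 2: "\<And>n. n > 0 \<Longrightarrow> poly q' (of_nat n) \<noteq> 0" "\<And>n. n > 0 \<Longrightarrow> d n = poly p' (of_nat n) / poly q' (of_nat n)"
    using assms(2) by (rule rational_at_posE) blast
  show ?thesis
  proof (rule rational_at_posI[of "q * q'" _ "p * p'"])
    fix n :: nat assume n: "n > 0"
    show "poly (q * q') (of_nat n) \<noteq> 0" using 1(1)[OF n] 2(1)[OF n] by simp
    show "c n * d n = poly (p * p') (of_nat n) / poly (q * q') (of_nat n)"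
      unfolding 1(2)[OF n] 2(2)[OF n] using 1(1)[OF n] 2(1)[OF n] by (simp add: field_simps)
  qed
qed

lemma rational_at_pos_uminus [rational_intros]:
  "rational_at_pos c \<Longrightarrow> rational_at_pos (\<lambda>n. - c n)"
  using rational_at_pos_mult[OF rational_at_pos_const, of c "-1"] by simp

lemma rational_at_pos_diff [rational_intros]:
  "rational_at_pos c \<Longrightarrow> rational_at_pos d \<Longrightarrow> rational_at_pos (\<lambda>n. c n - d n)"
  using rational_at_pos_add[of c "\<lambda>n. - d n"] rational_at_pos_uminus[of d] by simp

lemma rational_at_pos_div_of_nat [rational_intros]:
  "rational_at_pos c \<Longrightarrow> rational_at_pos (\<lambda>n. c n / of_nat n)"
  using rational_at_pos_mult[of c, OF _ rational_at_pos_inverse] by simp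

lemma rational_at_pos_power [rational_intros]:
  "rational_at_pos c \<Longrightarrow> rational_at_pos (\<lambda>n. c n ^ k)"
  by (induction k) (simp_all add: rational_intros)

lemma rational_at_pos_sum [rational_intros]:
  "(\<And>a. a \<in> A \<Longrightarrow> rational_at_pos (c a)) \<Longrightarrow> rational_at_pos (\<lambda>n. \<Sum>a\<in>A. c a n)"
  by (induction A rule: infinite_finite_induct) (simp_all add: rational_intros)

lemma rational_at_pos_prod [rational_intros]:
  "(\<And>a. a \<in> A \<Longrightarrow> rational_at_pos (c a)) \<Longrightarrow> rational_at_pos (\<lambda>n. \<Prod>a\<in>A. c a n)"
  by (induction A rule: infinite_finite_induct) (simp_all add: rational_intros)

text \<open>A zero of the numerator at \<open>n = s / b\<close> cancels the pole there.\<close>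

lemma rational_at_pos_divide_linear:
  assumes "rational_at_pos c" and zero: "\<And>n. n > 0 \<Longrightarrow> n * b = s \<Longrightarrow> c n = 0"
    and nontriv: "b > 0 \<or> s > 0"
  shows "\<exists>d. rational_at_pos d \<and> (\<forall>n>0. (of_nat n * of_nat b - of_nat s) * d n = c n)"
proof -
  obtain p q where pq: "\<And>n. n > 0 \<Longrightarrow> poly q (of_nat n) \<noteq> 0" "\<And>n. n > 0 \<Longrightarrow> c n = poly p (of_nat n) / poly q (of_nat n)"
    using assms(1) by (rule rational_at_posE) blast
  show ?thesis
  proof (cases "\<exists>m>0. m * b = s")
    case False
    then have nz: "of_nat n * of_nat b - of_nat s \<noteq> (0 :: rat)" if "n > 0" for n
      using that by (metis eq_iff_diff_eq_0 of_nat_eq_iff of_nat_mult)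
    have "rational_at_pos (\<lambda>n. c n / (of_nat n * of_nat b - of_nat s))"
    proof (rule rational_at_posI[of "q * [:- of_nat s, of_nat b:]" _ p])
      fix n :: nat assume n: "n > 0"
      have eq: "poly [:- of_nat s, of_nat b:] (of_nat n) = of_nat n * of_nat b - (of_nat s :: rat)"
        by simp
      show "poly (q * [:- of_nat s, of_nat b:]) (of_nat n) \<noteq> 0"
        unfolding poly_mult eq using pq(1)[OF n] nz[OF n] by simp
      show "c n / (of_nat n * of_nat b - of_nat s) =
          poly p (of_nat n) / poly (q * [:- of_nat s, of_nat b:]) (of_nat n)"
        unfolding poly_mult eq pq(2)[OF n] by simp
    qed
    moreover have "(of_nat n * of_nat b - of_nat s) * (c n / (of_nat n * of_nat b - of_nat s)) = c n"
      if "n > 0" for n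
      using nz[OF that] by simp
    ultimately show ?thesis by (intro exI[of _ "\<lambda>n. c n / (of_nat n * of_nat b - of_nat s)"]) simp
  next
    case True
    then obtain m where m: "m > 0" "m * b = s" by blast
    with nontriv have b: "b > 0" by (cases b) auto
    have "poly p (of_nat m) = 0" using zero[OF m] pq[OF m(1)] by simp
    then obtain p' where p': "p = [:- of_nat m, 1:] * p'"
      by (metis dvd_def poly_eq_0_iff_dvd)
    define d where "d n = poly p' (of_nat n) / (of_nat b * poly q (of_nat n))" for n
    have "rational_at_pos d"
      by (rule rational_at_posI[of "smult (of_nat b) q" _ p']) (use pq(1) b in \<open>simp_all add: d_def\<close>)
    moreover have "(of_nat n * of_nat b - of_nat s) * d n = c n" if "n > 0" for n
    proof -
      have s: "of_nat s = (of_nat m * of_nat b :: rat)" using m by (metis of_nat_mult)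
      have "(of_nat n * of_nat b - of_nat s) * d n = (of_nat n - of_nat m) * poly p' (of_nat n) / poly q (of_nat n)"
        using b pq(1)[OF that] unfolding d_def s by (simp add: left_diff_distrib diff_divide_distrib)
      also have "\<dots> = c n"
        using pq(2)[OF that] by (simp add: p' left_diff_distrib)
      finally show ?thesis .
    qed
    ultimately show ?thesis by blast
  qed
qed

text \<open>The reduced denominator divides the given one, so it has no zero where the latter has
  none.\<close>

lemma rational_at_pos_imp_ratfun:
  assumes "rational_at_pos c"
  shows "\<exists>f::ratfun. \<forall>n>0. regular_at (of_nat n) f \<and> ratfun_eval (of_nat n) f = c n"
proof -
  obtain p q where pq: "\<And>n. n > 0 \<Longrightarrow> poly q (of_nat n) \<noteq> 0" "\<And>n. n > 0 \<Longrightarrow> c n = poly p (of_nat n) / poly q (of_nat n)"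
    using assms by (rule rational_at_posE) blast
  have "q \<noteq> 0" using pq(1)[of 1] by auto
  define f where "f = Fract p q"
  define a where "a = fst (quot_of_fract f)"
  define b where "b = snd (quot_of_fract f)"
  have "b \<noteq> 0" by (simp add: b_def)
  have "Fract a b = Fract p q" by (simp add: a_def b_def f_def)
  then have ab: "a * q = p * b" using \<open>q \<noteq> 0\<close> \<open>b \<noteq> 0\<close> by (simp add: eq_fract)
  have "coprime a b"
    using quot_of_fract_in_normalized_fracts[of f]
    by (simp add: a_def b_def normalized_fracts_def case_prod_unfold)
  then have "b dvd q" using ab
    by (metis coprime_commute coprime_dvd_mult_right_iff dvd_triv_right)
  then obtain r where r: "q = b * r" by (elim dvdE)
  have "regular_at (of_nat n) f \<and> ratfun_eval (of_nat n) f = c n" if "n > 0" for n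
  proof -
    have nz: "poly b (of_nat n) \<noteq> 0" using pq(1)[OF that] r by auto
    moreover have "poly a (of_nat n) * poly q (of_nat n) = poly p (of_nat n) * poly b (of_nat n)"
      using ab by (metis poly_mult)
    ultimately show ?thesis using pq[OF that]
      by (simp add: regular_at_def ratfun_eval_def flip: a_def b_def) (simp add: field_simps)
  qed
  then show ?thesis by blast
qed

section \<open>Power sums and \<open>S_sym\<close> as polynomials in \<open>n\<close>\<close>

lemma sum_power_poly: "\<exists>p :: rat poly. \<forall>n. (\<Sum>i<n. of_nat i ^ k) = poly p (of_nat n)"
proof (induction k rule: less_induct)
  case (less k)
  then have "\<forall>j. \<exists>p. j < k \<longrightarrow> (\<forall>n. (\<Sum>i<n. of_nat i ^ j) = poly p (of_nat n :: rat))"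
    by blast
  then obtain P where P: "\<And>j n. j < k \<Longrightarrow> (\<Sum>i<n. of_nat i ^ j) = poly (P j) (of_nat n :: rat)"
    unfolding choice_iff by blast
  define p where "p = smult (1 / of_nat (Suc k)) (monom 1 (Suc k) - (\<Sum>j<k. smult (of_nat (Suc k choose j)) (P j)))"
  have "(\<Sum>i<n. of_nat i ^ k) = poly p (of_nat n)" for n
  proof -
    \<comment> \<open>The differences of consecutive powers with exponent \<open>k + 1\<close>
      telescope; their binomial expansions involve the wanted sum and power sums of smaller
      exponent.\<close>
    have "of_nat n ^ Suc k = (\<Sum>i<n. of_nat (Suc i) ^ Suc k - of_nat i ^ Suc k :: rat)"
      by (subst sum_lessThan_telescope) simp
    also have "\<dots> = (\<Sum>i<n. (\<Sum>j<k. of_nat (Suc k choose j) * of_nat i ^ j) + of_nat (Suc k) * of_nat i ^ k)"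
    proof (rule sum.cong[OF refl])
      fix i :: nat
      have "of_nat (Suc i) ^ Suc k = (of_nat i + 1 :: rat) ^ Suc k" by (simp add: add.commute)
      also have "\<dots> = (\<Sum>j\<le>Suc k. of_nat (Suc k choose j) * of_nat i ^ j)"
        by (subst binomial_ring) simp
      also have "\<dots> = (\<Sum>j<k. of_nat (Suc k choose j) * of_nat i ^ j) + of_nat (Suc k) * of_nat i ^ k + of_nat i ^ Suc k"
        by (simp add: lessThan_Suc_atMost[symmetric] del: binomial_Suc_Suc of_nat_Suc)
      finally show "of_nat (Suc i) ^ Suc k - of_nat i ^ Suc k =
          (\<Sum>j<k. of_nat (Suc k choose j) * of_nat i ^ j) + of_nat (Suc k) * (of_nat i ^ k :: rat)"
        by linarith
    qed
    also have "\<dots> = (\<Sum>j<k. of_nat (Suc k choose j) * poly (P j) (of_nat n)) + of_nat (Suc k) * (\<Sum>i<n. of_nat i ^ k)"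
      by (subst sum.distrib, subst sum.swap) (simp add: P sum_distrib_left[symmetric] del: of_nat_Suc binomial_Suc_Suc)
    finally have "of_nat (Suc k) * (\<Sum>i<n. of_nat i ^ k) =
      of_nat n ^ Suc k - (\<Sum>j<k. of_nat (Suc k choose j) * poly (P j) (of_nat n))" by simp
    then have "(\<Sum>i<n. of_nat i ^ k) = (of_nat n ^ Suc k - (\<Sum>j<k. of_nat (Suc k choose j) * poly (P j) (of_nat n))) / of_nat (Suc k)"
      by (simp add: field_simps del: of_nat_Suc binomial_Suc_Suc)
    then show ?thesis
      by (simp add: p_def poly_sum poly_monom del: of_nat_Suc binomial_Suc_Suc)
  qed
  then show ?case by (intro exI[of _ p] allI)
qed

lemma sum_poly_poly: "\<exists>q :: rat poly. \<forall>n. (\<Sum>i<n. poly p (of_nat i)) = poly q (of_nat n)"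
proof -
  obtain P where P: "\<And>k n. (\<Sum>i<n. of_nat i ^ k) = poly (P k) (of_nat n :: rat)"
    using choice[of "\<lambda>k p. \<forall>n. (\<Sum>i<n. of_nat i ^ k) = poly p (of_nat n :: rat)"] sum_power_poly by blast
  have "(\<Sum>i<n. poly p (of_nat i)) = poly (\<Sum>k\<le>degree p. smult (coeff p k) (P k)) (of_nat n)" for n
    unfolding poly_altdef[of p] by (subst sum.swap) (simp add: P poly_sum flip: sum_distrib_left)
  then show ?thesis by (intro exI allI)
qed

text \<open>Unrolling \<open>S_sym_Suc\<close> exhibits \<open>S_sym (Suc r) n\<close> as the sum of
  \<open>(m + 1) S_sym r m\<close> over \<open>m < n\<close>, and such sums of polynomial values are
  polynomial in \<open>n\<close>.\<close>

lemma S_sym_poly: "\<exists>p. \<forall>n. of_nat (S_sym r n) = poly p (of_nat n :: rat)"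
proof (induction r)
  case 0
  show ?case by (rule exI[of _ 1]) simp
next
  case (Suc r)
  then obtain p where p: "\<And>n. of_nat (S_sym r n) = poly p (of_nat n :: rat)" by blast
  have "of_nat (S_sym (Suc r) n) = (\<Sum>m<n. poly ([:1, 1:] * p) (of_nat m :: rat))" for n
    by (induction n) (simp_all add: S_sym_eq_0 S_sym_Suc p algebra_simps)
  moreover obtain q where "\<And>n. (\<Sum>i<n. poly ([:1, 1:] * p) (of_nat i)) = poly q (of_nat n :: rat)"
    using sum_poly_poly[of "[:1, 1:] * p"] by blast
  ultimately show ?case by (intro exI[of _ q] allI) (simp only:)
qed

lemma rational_at_pos_S_sym: "rational_at_pos (\<lambda>n. of_nat (S_sym r n))"
proof -
  obtain p where p: "\<And>n. of_nat (S_sym r n) = poly p (of_nat n :: rat)" using S_sym_poly by blast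
  show ?thesis unfolding p by (rule rational_at_pos_poly)
qed

lemma rational_at_pos_gbinomial:
  "rational_at_pos c \<Longrightarrow> rational_at_pos (\<lambda>n. c n gchoose k)"
  unfolding gbinomial_prod_rev divide_inverse by (intro rational_at_pos_mult rational_at_pos_prod rational_at_pos_diff rational_at_pos_const)

text \<open>For \<open>n < r\<close> the truncated subtraction spoils the polynomial form of the
  binomial coefficient. There \<open>S_sym r n\<close> vanishes, so the polynomial
  \<open>gchoose\<close> may take its place.\<close>

lemma rational_at_pos_binomial_S_sym:
  "rational_at_pos (\<lambda>n. of_nat ((n - r) choose i) * of_nat (S_sym r n))"
proof -
  have eq: "((of_nat n - of_nat r) gchoose i) * of_nat (S_sym r n) = (of_nat ((n - r) choose i) * of_nat (S_sym r n) :: rat)" for n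
    by (cases "n < r") (simp_all add: S_sym_eq_0 binomial_gbinomial of_nat_diff)
  have "rational_at_pos (\<lambda>n. ((of_nat n - of_nat r) gchoose i) * of_nat (S_sym r n))"
    by (intro rational_at_pos_mult rational_at_pos_gbinomial rational_at_pos_diff rational_at_pos_S_sym
          rational_at_pos_of_nat rational_at_pos_const)
  then show ?thesis unfolding eq .
qed

text \<open>The degree bound is uniform in \<open>n\<close>, so that evaluation and division by
  \<open>X - 1\<close> become sums of a fixed number of rational functions.\<close>

definition rational_poly_at_pos :: "(nat \<Rightarrow> rat poly) \<Rightarrow> bool" where
  "rational_poly_at_pos g \<longleftrightarrow>
     (\<exists>B. \<forall>n>0. degree (g n) \<le> B) \<and> (\<forall>b. rational_at_pos (\<lambda>n. coeff (g n) b))"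

lemma rational_poly_at_posI:
  "(\<And>n. n > 0 \<Longrightarrow> degree (g n) \<le> B) \<Longrightarrow> (\<And>b. rational_at_pos (\<lambda>n. coeff (g n) b)) \<Longrightarrow> rational_poly_at_pos g"
  unfolding rational_poly_at_pos_def by blast

lemma rational_poly_at_posD [rational_intros]:
  "rational_poly_at_pos g \<Longrightarrow> rational_at_pos (\<lambda>n. coeff (g n) b)"
  by (simp add: rational_poly_at_pos_def)

lemma rational_poly_at_pos_bound:
  "rational_poly_at_pos g \<Longrightarrow> \<exists>B. \<forall>n>0. degree (g n) \<le> B"
  by (simp add: rational_poly_at_pos_def)

lemma rational_poly_at_pos_cong:
  assumes g: "rational_poly_at_pos g" and eq: "\<And>n. n > 0 \<Longrightarrow> g n = h n"
  shows "rational_poly_at_pos h"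
proof -
  obtain B where B: "\<forall>n>0. degree (g n) \<le> B" using rational_poly_at_pos_bound[OF g] ..
  show ?thesis
  proof (rule rational_poly_at_posI)
    show "degree (h n) \<le> B" if "n > 0" for n
      using B[rule_format, OF that] eq[OF that] by simp
    show "rational_at_pos (\<lambda>n. coeff (h n) b)" for b
      by (rule rational_at_pos_cong[OF rational_poly_at_posD[OF g, of b]]) (simp add: eq)
  qed
qed

lemma rational_poly_at_pos_const [rational_intros]: "rational_poly_at_pos (\<lambda>n. p)"
  by (rule rational_poly_at_posI[where B = "degree p"]) (simp_all add: rational_intros)

lemma rational_poly_at_pos_add [rational_intros]:
  assumes "rational_poly_at_pos g" "rational_poly_at_pos h"
  shows "rational_poly_at_pos (\<lambda>n. g n + h n)"
proof -
  obtain B where B: "\<forall>n>0. degree (g n) \<le> B" using rational_poly_at_pos_bound[OF assms(1)] ..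
  obtain B' where B': "\<forall>n>0. degree (h n) \<le> B'" using rational_poly_at_pos_bound[OF assms(2)] ..
  show ?thesis
  proof (rule rational_poly_at_posI)
    show "degree (g n + h n) \<le> max B B'" if "n > 0" for n
      using B[rule_format, OF that] B'[rule_format, OF that] by (intro degree_add_le) simp_all
    show "rational_at_pos (\<lambda>n. coeff (g n + h n) b)" for b
      unfolding coeff_add by (intro rational_intros assms)
  qed
qed

lemma rational_poly_at_pos_mult [rational_intros]:
  assumes "rational_poly_at_pos g" "rational_poly_at_pos h"
  shows "rational_poly_at_pos (\<lambda>n. g n * h n)"
proof -
  obtain B where B: "\<forall>n>0. degree (g n) \<le> B" using rational_poly_at_pos_bound[OF assms(1)] ..
  obtain B' where B': "\<forall>n>0. degree (h n) \<le> B'" using rational_poly_at_pos_bound[OF assms(2)] ..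
  show ?thesis
  proof (rule rational_poly_at_posI)
    show "degree (g n * h n) \<le> B + B'" if "n > 0" for n
      using degree_mult_le[of "g n" "h n"] B B' that by (meson add_mono le_trans)
    show "rational_at_pos (\<lambda>n. coeff (g n * h n) b)" for b
      unfolding coeff_mult by (intro rational_intros assms)
  qed
qed

lemma rational_poly_at_pos_sum [rational_intros]:
  "(\<And>a. a \<in> A \<Longrightarrow> rational_poly_at_pos (g a)) \<Longrightarrow> rational_poly_at_pos (\<lambda>n. \<Sum>a\<in>A. g a n)"
  by (induction A rule: infinite_finite_induct) (simp_all add: rational_intros)

lemma rational_poly_at_pos_smult [rational_intros]:
  assumes "rational_at_pos c" "rational_poly_at_pos g"
  shows "rational_poly_at_pos (\<lambda>n. smult (c n) (g n))"
proof -
  obtain B where B: "\<forall>n>0. degree (g n) \<le> B" using rational_poly_at_pos_bound[OF assms(2)] ..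
  show ?thesis
  proof (rule rational_poly_at_posI)
    show "degree (smult (c n) (g n)) \<le> B" if "n > 0" for n
      using degree_smult_le[of "c n" "g n"] B that by (meson le_trans)
    show "rational_at_pos (\<lambda>n. coeff (smult (c n) (g n)) b)" for b
      unfolding coeff_smult by (intro rational_intros assms)
  qed
qed

lemma rational_poly_at_pos_diff [rational_intros]:
  assumes "rational_poly_at_pos g" "rational_poly_at_pos h"
  shows "rational_poly_at_pos (\<lambda>n. g n - h n)"
proof -
  have "rational_poly_at_pos (\<lambda>n. g n + smult (-1) (h n))"
    by (intro rational_intros assms)
  then show ?thesis by simp
qed

lemma rational_poly_at_pos_pderiv [rational_intros]:
  assumes "rational_poly_at_pos g"
  shows "rational_poly_at_pos (\<lambda>n. pderiv (g n))"
proof -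
  obtain B where B: "\<forall>n>0. degree (g n) \<le> B" using rational_poly_at_pos_bound[OF assms] ..
  show ?thesis
  proof (rule rational_poly_at_posI)
    show "degree (pderiv (g n)) \<le> B" if "n > 0" for n
      using B[rule_format, OF that] by (simp add: degree_pderiv)
    show "rational_at_pos (\<lambda>n. coeff (pderiv (g n)) b)" for b
      unfolding coeff_pderiv by (intro rational_intros assms)
  qed
qed

lemma rational_at_pos_poly_eval [rational_intros]:
  assumes "rational_poly_at_pos g"
  shows "rational_at_pos (\<lambda>n. poly (g n) a)"
proof -
  obtain B where B: "\<forall>n>0. degree (g n) \<le> B" using rational_poly_at_pos_bound[OF assms] ..
  show ?thesis
  proof (rule rational_at_pos_cong)
    show "rational_at_pos (\<lambda>n. \<Sum>b\<le>B. coeff (g n) b * a ^ b)"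
      by (intro rational_intros assms)
    show "(\<Sum>b\<le>B. coeff (g n) b * a ^ b) = poly (g n) a" if "n > 0" for n
      using B[rule_format, OF that]
      unfolding poly_altdef by (intro sum.mono_neutral_right) (auto simp: coeff_eq_0)
  qed
qed

text \<open>The coefficient of \<open>X^b\<close> in \<open>g n\<close> is the sum of the
  coefficients of \<open>(X - 1) g n\<close> at all exponents above \<open>b\<close>; the sum
  telescopes, and the degree bound fixes its length.\<close>

lemma rational_poly_at_pos_cancel:
  assumes "rational_poly_at_pos (\<lambda>n. [:-1, 1:] * g n)"
  shows "rational_poly_at_pos g"
proof -
  obtain B where B: "\<forall>n>0. degree ([:-1, 1:] * g n) \<le> B" using rational_poly_at_pos_bound[OF assms] ..
  have deg: "degree (g n) \<le> B" if "n > 0" for n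
  proof (cases "g n = 0")
    case False
    then have "degree ([:-1, 1:] * g n) = Suc (degree (g n))" by (subst degree_mult_eq) auto
    moreover have "degree ([:-1, 1:] * g n) \<le> B" using B that by blast
    ultimately show ?thesis by linarith
  qed simp
  have "rational_at_pos (\<lambda>n. coeff (g n) b)" for b
  proof (rule rational_at_pos_cong)
    show "rational_at_pos (\<lambda>n. \<Sum>c=Suc b..<Suc (b + Suc B). coeff ([:-1, 1:] * g n) c)"
      by (intro rational_at_pos_sum rational_poly_at_posD assms)
    show "(\<Sum>c=Suc b..<Suc (b + Suc B). coeff ([:-1, 1:] * g n) c) = coeff (g n) b" if "n > 0" for n
    proof -
      have "(\<Sum>c=Suc b..<Suc (b + Suc B). coeff ([:-1, 1:] * g n) c) =
            (\<Sum>c=b..<b + Suc B. coeff ([:-1, 1:] * g n) (Suc c))"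
        by (rule sum.shift_bounds_Suc_ivl)
      also have "\<dots> = (\<Sum>c=b..<b + Suc B. - (coeff (g n) (Suc c) - coeff (g n) c))"
        by (simp add: coeff_pCons)
      also have "\<dots> = coeff (g n) b - coeff (g n) (b + Suc B)"
        unfolding sum_negf by (subst sum_Suc_diff') auto
      also have "coeff (g n) (b + Suc B) = 0"
        using deg[OF that] by (intro coeff_eq_0) simp
      finally show ?thesis by simp
    qed
  qed
  then show ?thesis by (intro rational_poly_at_posI[where g = g and B = B] deg)
qed

section \<open>Polynomial dependence on a second index\<close>

definition rational_poly_family :: "(nat \<Rightarrow> nat \<Rightarrow> rat poly) \<Rightarrow> bool" where
  "rational_poly_family h \<longleftrightarrow>
     (\<exists>E u. (\<forall>e\<in>{..<E}. rational_poly_at_pos (u e)) \<and>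
        (\<forall>n>0. \<forall>m. h n m = (\<Sum>e<E. smult (of_nat m ^ e) (u e n))))"

lemma rational_poly_familyI:
  "(\<And>e. e < E \<Longrightarrow> rational_poly_at_pos (u e)) \<Longrightarrow>
   (\<And>n m. n > 0 \<Longrightarrow> h n m = (\<Sum>e<E. smult (of_nat m ^ e) (u e n))) \<Longrightarrow> rational_poly_family h"
  unfolding rational_poly_family_def by (intro exI[of _ E] exI[of _ u]) auto

lemma rational_poly_familyE:
  assumes "rational_poly_family h"
  obtains E u where "\<And>e. e < E \<Longrightarrow> rational_poly_at_pos (u e)"
    "\<And>n m. n > 0 \<Longrightarrow> h n m = (\<Sum>e<E. smult (of_nat m ^ e) (u e n))"
  using assms unfolding rational_poly_family_def by (metis lessThan_iff)

lemma rational_poly_family_const: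
  "rational_poly_at_pos g \<Longrightarrow> rational_poly_family (\<lambda>n m. g n)"
  by (rule rational_poly_familyI[of 1 "\<lambda>_. g"]) simp_all

lemma rational_poly_family_add:
  assumes "rational_poly_family g" "rational_poly_family h"
  shows "rational_poly_family (\<lambda>n m. g n m + h n m)"
proof -
  obtain E u where u: "\<And>e. e < E \<Longrightarrow> rational_poly_at_pos (u e)"
    "\<And>n m. n > 0 \<Longrightarrow> g n m = (\<Sum>e<E. smult (of_nat m ^ e) (u e n))"
    using assms(1) by (rule rational_poly_familyE) blast
  obtain E' u' where u': "\<And>e. e < E' \<Longrightarrow> rational_poly_at_pos (u' e)"
    "\<And>n m. n > 0 \<Longrightarrow> h n m = (\<Sum>e<E'. smult (of_nat m ^ e) (u' e n))"
    using assms(2) by (rule rational_poly_familyE) blast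
  define v where "v e n = (if e < E then u e n else 0)" for e n
  define v' where "v' e n = (if e < E' then u' e n else 0)" for e n
  have 1: "g n m = (\<Sum>e<max E E'. smult (of_nat m ^ e) (v e n))" if "n > 0" for n m
    unfolding u(2)[OF that] by (rule sum.mono_neutral_cong_left) (auto simp: v_def)
  have 2: "h n m = (\<Sum>e<max E E'. smult (of_nat m ^ e) (v' e n))" if "n > 0" for n m
    unfolding u'(2)[OF that] by (rule sum.mono_neutral_cong_left) (auto simp: v'_def)
  have 3: "rational_poly_at_pos (v e)" "rational_poly_at_pos (v' e)" for e
    using u(1)[of e] u'(1)[of e] unfolding v_def v'_def by (cases "e < E"; cases "e < E'"; simp add: rational_intros)+
  show ?thesis
    by (rule rational_poly_familyI[of "max E E'" "\<lambda>e n. v e n + v' e n"])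
       (use 3 in \<open>simp_all add: 1 2 sum.distrib smult_add_right rational_intros\<close>)
qed

lemma rational_poly_family_sum:
  "(\<And>a. a \<in> A \<Longrightarrow> rational_poly_family (h a)) \<Longrightarrow> rational_poly_family (\<lambda>n m. \<Sum>a\<in>A. h a n m)"
  by (induction A rule: infinite_finite_induct)
     (simp_all add: rational_poly_family_add rational_poly_family_const rational_poly_at_pos_const)

lemma rational_poly_family_map:
  assumes "rational_poly_family h"
    and T: "\<And>g. rational_poly_at_pos g \<Longrightarrow> rational_poly_at_pos (\<lambda>n. T n (g n))"
    and add: "\<And>n p q. T n (p + q) = T n p + T n q" and smult: "\<And>n c p. T n (smult c p) = smult c (T n p)"
  shows "rational_poly_family (\<lambda>n m. T n (h n m))"
proof -
  obtain E u where u: "\<And>e. e < E \<Longrightarrow> rational_poly_at_pos (u e)"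
    "\<And>n m. n > 0 \<Longrightarrow> h n m = (\<Sum>e<E. smult (of_nat m ^ e) (u e n))"
    using assms(1) by (rule rational_poly_familyE) blast
  have "T n (sum f A) = (\<Sum>a\<in>A. T n (f a))" if "finite A" for n f and A :: "nat set"
    \<comment> \<open>Homogeneity with the scalar 0 gives \<open>T n 0 = 0\<close>, which settles
      the empty sum.\<close>
    using that by (induction A rule: finite_induct) (use smult[of n 0 0] in \<open>auto simp: add\<close>)
  then show ?thesis
    by (intro rational_poly_familyI[of E "\<lambda>e n. T n (u e n)"]) (simp_all add: u smult T)
qed

lemma smult_sum_right: "smult c (sum f A) = (\<Sum>a\<in>A. smult c (f a))"
  by (induction A rule: infinite_finite_induct) (auto simp: smult_add_right)

lemma rational_poly_family_index_mult:
  assumes "rational_poly_family h"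
  shows "rational_poly_family (\<lambda>n m. smult (of_nat m) (h n m))"
proof -
  obtain E u where u: "\<And>e. e < E \<Longrightarrow> rational_poly_at_pos (u e)"
    "\<And>n m. n > 0 \<Longrightarrow> h n m = (\<Sum>e<E. smult (of_nat m ^ e) (u e n))"
    using assms by (rule rational_poly_familyE) blast
  show ?thesis
  proof (rule rational_poly_familyI)
    show "rational_poly_at_pos (case e of 0 \<Rightarrow> \<lambda>_. 0 | Suc e \<Rightarrow> u e)" if "e < Suc E" for e
      using that u by (cases e) (simp_all add: rational_intros)
    show "smult (of_nat m) (h n m) = (\<Sum>e<Suc E. smult (of_nat m ^ e) ((case e of 0 \<Rightarrow> \<lambda>_. 0 | Suc e \<Rightarrow> u e) n))"
      if "n > 0" for n m
      by (subst sum.lessThan_Suc_shift) (simp add: u(2)[OF that] smult_sum_right)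
  qed
qed

lemma rational_poly_family_power_sum:
  assumes "rational_poly_at_pos g"
  shows "rational_poly_family (\<lambda>n m. smult (\<Sum>i<m. of_nat i ^ k) (g n))"
proof -
  obtain p where p: "\<And>m. (\<Sum>i<m. of_nat i ^ k) = poly p (of_nat m :: rat)"
    using sum_power_poly by blast
  show ?thesis
    by (rule rational_poly_familyI[of "Suc (degree p)" "\<lambda>e n. smult (coeff p e) (g n)"])
       (use assms in \<open>simp_all add: p poly_altdef lessThan_Suc_atMost mult.commute smult_sum rational_intros\<close>)
qed

lemma rational_poly_family_partial_sums:
  assumes "rational_poly_family h"
  shows "rational_poly_family (\<lambda>n m. \<Sum>i<m. h n i)"
proof -
  obtain E u where u: "\<And>e. e < E \<Longrightarrow> rational_poly_at_pos (u e)"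
    "\<And>n m. n > 0 \<Longrightarrow> h n m = (\<Sum>e<E. smult (of_nat m ^ e) (u e n))"
    using assms by (rule rational_poly_familyE) blast
  have "rational_poly_family (\<lambda>n m. \<Sum>e<E. smult (\<Sum>i<m. of_nat i ^ e) (u e n))"
    using u(1) by (intro rational_poly_family_sum rational_poly_family_power_sum) simp
  then obtain E' u' where u': "\<And>e. e < E' \<Longrightarrow> rational_poly_at_pos (u' e)"
    "\<And>n m. n > 0 \<Longrightarrow> (\<Sum>e<E. smult (\<Sum>i<m. of_nat i ^ e) (u e n)) = (\<Sum>e<E'. smult (of_nat m ^ e) (u' e n))"
    by (rule rational_poly_familyE) blast
  show ?thesis
  proof (rule rational_poly_familyI[of E' u'])
    show "(\<Sum>i<m. h n i) = (\<Sum>e<E'. smult (of_nat m ^ e) (u' e n))" if "n > 0" for n m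
      unfolding u'(2)[OF that, symmetric] u(2)[OF that] by (subst sum.swap) (simp add: smult_sum)
  qed (use u' in auto)
qed

text \<open>In \<open>m\<close> the recursion is a difference equation: column \<open>j + 1\<close>
  consists of partial sums of a linear image of column \<open>j\<close>. The operators
  \<open>T\<close> and \<open>U\<close> separate the part of \<open>(m - j)/n\<close> that is
  constant in \<open>m\<close> from the part that is linear in it.\<close>

lemma rational_poly_family_H_poly: "rational_poly_family (\<lambda>n m. H_poly n m j)"
proof (induction j)
  case 0
  show ?case by (simp add: rational_poly_family_const rational_poly_at_pos_const)
next
  case (Suc j)
  define T where "T n p = ([:0, 1:] - 1) * ([:0, 1:] * pderiv p + smult (- of_nat j / of_nat n) p)"
    for n :: nat and p :: "rat poly"
  define U where "U n p = ([:0, 1:] - 1) * smult (1 / of_nat n) p" for n :: nat and p :: "rat poly"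
  have T_rat: "rational_poly_at_pos (\<lambda>n. T n (g n))" if "rational_poly_at_pos g" for g
    unfolding T_def using that
    by (intro rational_poly_at_pos_mult rational_poly_at_pos_add rational_poly_at_pos_smult
         rational_poly_at_pos_const rational_poly_at_pos_pderiv rational_at_pos_div_of_nat
         rational_at_pos_const)
  have U_rat: "rational_poly_at_pos (\<lambda>n. U n (g n))" if "rational_poly_at_pos g" for g
    unfolding U_def using that
    by (intro rational_poly_at_pos_mult rational_poly_at_pos_const rational_poly_at_pos_smult
         rational_at_pos_inverse)
  have T_smult: "T n (smult c p) = smult c (T n p)" for n c p
  proof -
    have "[:0, 1:] * pderiv (smult c p) + smult (- of_nat j / of_nat n) (smult c p) =
        smult c ([:0, 1:] * pderiv p + smult (- of_nat j / of_nat n) p)"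
      by (simp only: pderiv_smult mult_smult_right smult_add_right smult_smult mult.commute[of c])
    then show ?thesis unfolding T_def by (simp only: mult_smult_right)
  qed
  have U_smult: "U n (smult c p) = smult c (U n p)" for n c p
    unfolding U_def by (simp only: mult_smult_right smult_smult mult.commute[of c])
  have T_add: "T n (p + q) = T n p + T n q" for n p q
    unfolding T_def pderiv_add smult_add_right by (simp only: distrib_left distrib_right ac_simps)
  have U_add: "U n (p + q) = U n p + U n q" for n p q
    unfolding U_def smult_add_right by (simp only: distrib_left)
  have T: "rational_poly_family (\<lambda>n m. T n (H_poly n m j))"
    using Suc T_rat T_add T_smult by (rule rational_poly_family_map)
  have U: "rational_poly_family (\<lambda>n m. U n (smult (of_nat m) (H_poly n m j)))"
    using rational_poly_family_index_mult[OF Suc] U_rat U_add U_smult by (rule rational_poly_family_map)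
  have "H_poly n m (Suc j) = (\<Sum>i<m. T n (H_poly n i j) + U n (smult (of_nat i) (H_poly n i j)))" for n m
  proof (induction m)
    case (Suc m)
    have "smult ((of_nat (Suc m) - of_nat (Suc j)) / of_nat n) p =
        smult (- of_nat j / of_nat n) p + smult (1 / of_nat n) (smult (of_nat m) p)" for p :: "rat poly"
      by (simp add: smult_diff_left diff_divide_distrib)
    then have "H_poly n (Suc m) (Suc j) = H_poly n m (Suc j) + (T n (H_poly n m j) + U n (smult (of_nat m) (H_poly n m j)))"
      unfolding H_poly.simps T_def U_def by (simp only: distrib_left add.assoc)
    then show ?case using Suc by simp
  qed simp
  then show ?case
    using rational_poly_family_partial_sums[OF rational_poly_family_add[OF T U]] by simp
qed

text \<open>For \<open>n < q\<close> the truncated difference is 0 instead of negative. The factor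
  \<open>c n\<close> vanishes there, so the polynomial in the second index may be evaluated at the
  true difference.\<close>

lemma rational_poly_family_subst:
  assumes "rational_poly_family h" "rational_at_pos c" and zero: "\<And>n. n < q \<Longrightarrow> c n = 0"
  shows "rational_poly_at_pos (\<lambda>n. smult (c n) (h n (n - q)))"
proof -
  obtain E u where u: "\<And>e. e < E \<Longrightarrow> rational_poly_at_pos (u e)"
    "\<And>n m. n > 0 \<Longrightarrow> h n m = (\<Sum>e<E. smult (of_nat m ^ e) (u e n))"
    using assms(1) by (rule rational_poly_familyE) blast
  have u_rat: "rational_poly_at_pos (u e)" if "e \<in> {..<E}" for e
    using u(1) that by simp
  show ?thesis
  proof (rule rational_poly_at_pos_cong)
    show "rational_poly_at_pos (\<lambda>n. smult (c n) (\<Sum>e<E. smult ((of_nat n - of_nat q) ^ e) (u e n)))"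
      by (intro rational_poly_at_pos_smult rational_poly_at_pos_sum
        rational_at_pos_power rational_at_pos_diff rational_at_pos_of_nat rational_at_pos_const u_rat assms(2))
    show "smult (c n) (\<Sum>e<E. smult ((of_nat n - of_nat q) ^ e) (u e n)) = smult (c n) (h n (n - q))"
      if "n > 0" for n
      using that zero[of n] by (cases "n < q") (simp_all add: u of_nat_diff)
  qed
qed

lemma rational_poly_at_pos_A_coeff: "rational_poly_at_pos (\<lambda>n. A_coeff n k i)"
proof -
  have "rational_at_pos (\<lambda>n. of_nat (n choose i))"
    using rational_at_pos_binomial_S_sym[of 0 i] by simp
  then have "rational_poly_at_pos (\<lambda>n. smult (of_nat (n choose i)) (H_poly n (n - i) (k - i)))"
    by (intro rational_poly_family_subst rational_poly_family_H_poly) auto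
  moreover have "rational_poly_at_pos (\<lambda>n. smult (of_nat ((n - r) choose i) * (of_nat (S_sym r n) / of_nat n ^ r))
        (H_poly n (n - (i + r)) (k - i - r)))" for r
  proof (intro rational_poly_family_subst rational_poly_family_H_poly)
    show "of_nat ((n - r) choose i) * (of_nat (S_sym r n) / of_nat n ^ r) = (0::rat)" if "n < i + r" for n
      using that by (cases "n < r") (auto simp: S_sym_eq_0 binomial_eq_0)
    show "rational_at_pos (\<lambda>n. of_nat ((n - r) choose i) * (of_nat (S_sym r n) / of_nat n ^ r))"
      using rational_at_pos_mult[OF rational_at_pos_binomial_S_sym rational_at_pos_power[OF rational_at_pos_inverse]]
      by (simp add: power_one_over field_simps)
  qed
  ultimately show ?thesis
    unfolding A_coeff_def of_nat_poly mult_pCons_left[of "of_nat _"]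
    by (intro rational_poly_at_pos_diff rational_poly_at_pos_mult rational_poly_at_pos_sum rational_poly_at_pos_const) simp_all
qed

section \<open>Expansion at infinity\<close>

unbundle fps_syntax

interpretation at_inf: rat_hom "fls_const :: rat \<Rightarrow> rat fls" "fls_X_inv"
  by unfold_locales (simp_all add: fls_plus_const)

lemma nth_at_inf_ev: "at_inf.ev p $$ j = (if j \<le> 0 then coeff p (nat (- j)) else 0)"
proof (induction p arbitrary: j)
  case (pCons a p)
  have "nat (- j) = Suc (nat (- j - 1))" if "j < 0" using that by linarith
  then show ?case
    by (auto simp: at_inf.ev_pCons fls_X_inv_times_conv_shift pCons coeff_pCons split: nat.splits)
qed simp

text \<open>Injectivity lets the evaluation extend from polynomials in \<open>w\<close> to
  fractions.\<close>

lemma at_inf_ev_eq_0_iff: "at_inf.ev p = 0 \<longleftrightarrow> p = 0"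
proof
  assume "at_inf.ev p = 0"
  then have "coeff p k = 0" for k
    using nth_at_inf_ev[of p "- int k"] by simp
  then show "p = 0" by (simp add: poly_eq_iff)
qed simp

text \<open>\<open>expand_at_infinity\<close> reads off the reduced fraction; once any
  representation is allowed, additivity and multiplicativity follow from fraction
  arithmetic.\<close>

lemma expand_Fract:
  assumes "b \<noteq> 0"
  shows "expand_at_infinity (Fract a b) = at_inf.ev a / at_inf.ev b"
proof -
  define a' b' where "a' = fst (quot_of_fract (Fract a b))" and "b' = snd (quot_of_fract (Fract a b))"
  have "b' \<noteq> 0" by (simp add: b'_def)
  have "Fract a' b' = Fract a b" by (simp add: a'_def b'_def)
  then have "a' * b = a * b'" using assms \<open>b' \<noteq> 0\<close> by (simp add: eq_fract)
  then have "at_inf.ev a' * at_inf.ev b = at_inf.ev a * at_inf.ev b'"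
    by (metis at_inf.ev_mult)
  moreover have "at_inf.ev b \<noteq> 0" "at_inf.ev b' \<noteq> 0"
    using assms \<open>b' \<noteq> 0\<close> by (simp_all add: at_inf_ev_eq_0_iff)
  ultimately have "at_inf.ev a' / at_inf.ev b' = at_inf.ev a / at_inf.ev b"
    by (simp add: frac_eq_eq)
  then show ?thesis
    by (simp add: expand_at_infinity_def at_inf.ev_def a'_def b'_def)
qed

lemma expand_to_fract: "expand_at_infinity (to_fract p) = at_inf.ev p"
  by (simp add: to_fract_def expand_Fract)

lemma expand_0 [simp]: "expand_at_infinity 0 = 0"
  using expand_to_fract[of 0] by simp

lemma expand_1 [simp]: "expand_at_infinity 1 = 1"
  using expand_to_fract[of 1] by simp

lemma expand_add: "expand_at_infinity (f + g) = expand_at_infinity f + expand_at_infinity g"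
proof (cases f; cases g)
  fix a b c d assume "f = Fract a b" "b \<noteq> 0" "g = Fract c d" "d \<noteq> 0"
  then show ?thesis
    by (simp add: expand_Fract at_inf.ev_add at_inf.ev_mult at_inf_ev_eq_0_iff add_frac_eq)
qed

lemma expand_mult: "expand_at_infinity (f * g) = expand_at_infinity f * expand_at_infinity g"
proof (cases f; cases g)
  fix a b c d assume "f = Fract a b" "b \<noteq> 0" "g = Fract c d" "d \<noteq> 0"
  then show ?thesis
    by (simp add: expand_Fract at_inf.ev_mult at_inf_ev_eq_0_iff)
qed

lemma expand_diff: "expand_at_infinity (f - g) = expand_at_infinity f - expand_at_infinity g"
  using expand_add[of "f - g" g] by simp

lemma expand_sum: "expand_at_infinity (sum f A) = (\<Sum>a\<in>A. expand_at_infinity (f a))"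
  by (induction A rule: infinite_finite_induct) (auto simp: expand_add)

lemma expand_prod: "expand_at_infinity (prod f A) = (\<Prod>a\<in>A. expand_at_infinity (f a))"
  by (induction A rule: infinite_finite_induct) (auto simp: expand_mult)

lemma expand_power: "expand_at_infinity (f ^ k) = expand_at_infinity f ^ k"
  by (induction k) (auto simp: expand_mult)

lemma expand_of_nat: "expand_at_infinity (of_nat k) = of_nat k"
  by (induction k) (auto simp: expand_add)

lemma expand_eq_0_iff: "expand_at_infinity f = 0 \<longleftrightarrow> f = 0"
proof (cases f)
  case (Fract a b)
  then show ?thesis by (simp add: expand_Fract at_inf_ev_eq_0_iff eq_fract Zero_fract_def)
qed

lemma expand_w_var: "expand_at_infinity w_var = fls_X_inv"
  by (simp add: w_var_def expand_to_fract at_inf.ev_X)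

section \<open>Power series in \<open>x\<close> over Laurent series in \<open>1/w\<close>\<close>

definition expand_fps :: "ratfun fps \<Rightarrow> rat fls fps" where
  "expand_fps G = Abs_fps (\<lambda>d. expand_at_infinity (G $ d))"

lemma expand_fps_nth [simp]: "expand_fps G $ d = expand_at_infinity (G $ d)"
  by (simp add: expand_fps_def)

lemma expand_fps_1 [simp]: "expand_fps 1 = 1"
  by (rule fps_ext) simp

lemma expand_fps_mult: "expand_fps (G * H) = expand_fps G * expand_fps H"
  by (rule fps_ext) (simp add: fps_mult_nth expand_sum expand_mult)

lemma expand_fps_deriv: "expand_fps (fps_deriv G) = fps_deriv (expand_fps G)"
  by (rule fps_ext) (simp add: expand_mult expand_of_nat expand_add)

lemma expand_fps_const: "expand_fps (fps_const c) = fps_const (expand_at_infinity c)"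
  by (rule fps_ext) simp

lemma expand_fps_inverse:
  assumes "G $ 0 \<noteq> 0"
  shows "expand_fps (inverse G) = inverse (expand_fps G)"
proof -
  have "expand_fps G * expand_fps (inverse G) = 1"
    using inverse_mult_eq_1'[OF assms] by (simp flip: expand_fps_mult)
  moreover have "expand_fps G $ 0 \<noteq> 0" using assms by (simp add: expand_eq_0_iff)
  ultimately show ?thesis
    by (metis fps_inverse_unique)
qed

definition lift :: "rat fps \<Rightarrow> rat fls fps" where
  "lift u = Abs_fps (\<lambda>d. fls_const (u $ d))"

lemma lift_nth [simp]: "lift u $ d = fls_const (u $ d)"
  by (simp add: lift_def)

lemma fls_const_sum: "fls_const (sum f A) = (\<Sum>a\<in>A. fls_const (f a))"
  by (induction A rule: infinite_finite_induct) (auto simp: fls_plus_const[symmetric])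

lemma lift_0 [simp]: "lift 0 = 0" by (rule fps_ext) simp
lemma lift_1 [simp]: "lift 1 = 1" by (rule fps_ext) simp

lemma lift_add: "lift (u + v) = lift u + lift v"
  by (rule fps_ext) (simp add: fls_plus_const)

lemma lift_diff: "lift (u - v) = lift u - lift v"
  using lift_add[of "u - v" v] by simp

lemma lift_mult: "lift (u * v) = lift u * lift v"
  by (rule fps_ext) (simp add: fps_mult_nth fls_const_sum fls_const_mult_const)

lemma lift_power: "lift (u ^ k) = lift u ^ k"
  by (induction k) (auto simp: lift_mult)

lemma lift_deriv: "lift (fps_deriv u) = fps_deriv (lift u)"
  by (rule fps_ext) (simp add: fls_of_nat fls_const_mult_const fls_plus_const)

text \<open>The index \<open>j\<close> refers to \<open>w^(-j)\<close>, in line with the uniformizer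
  \<open>1/w\<close>; multiplying by \<open>w^e\<close> therefore raises the index that is
  read.\<close>

definition w_coeff :: "int \<Rightarrow> rat fls fps \<Rightarrow> rat fps" where
  "w_coeff j G = Abs_fps (\<lambda>d. G $ d $$ j)"

lemma w_coeff_nth [simp]: "w_coeff j G $ d = G $ d $$ j"
  by (simp add: w_coeff_def)

lemma coeff_at_infinity_eq: "coeff_at_infinity G j = w_coeff j (expand_fps G)"
  by (rule fps_ext) (simp add: coeff_at_infinity_def)

lemma w_coeff_eqI: "(\<And>j. w_coeff j G = w_coeff j H) \<Longrightarrow> G = H"
  by (rule fps_ext, rule fls_eqI) (metis w_coeff_nth)

lemma w_coeff_0 [simp]: "w_coeff j 0 = 0"
  by (rule fps_ext) simp

lemma w_coeff_add: "w_coeff j (G + H) = w_coeff j G + w_coeff j H"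
  by (rule fps_ext) simp

lemma w_coeff_diff: "w_coeff j (G - H) = w_coeff j G - w_coeff j H"
  by (rule fps_ext) simp

lemma fls_nth_sum: "(\<Sum>a\<in>A. f a) $$ j = (\<Sum>a\<in>A. f a $$ j)"
  by (induction A rule: infinite_finite_induct) auto

lemma w_coeff_sum: "w_coeff j (sum f A) = (\<Sum>a\<in>A. w_coeff j (f a))"
  by (induction A rule: infinite_finite_induct) (auto simp: w_coeff_add)

lemma w_coeff_lift_mult: "w_coeff j (lift u * G) = u * w_coeff j G"
  by (rule fps_ext) (simp add: fps_mult_nth fls_nth_sum)

lemma w_coeff_w_power_mult: "w_coeff j (fps_const fls_X_inv ^ e * G) = w_coeff (j + int e) G"
  by (rule fps_ext) (simp add: fps_const_power fls_X_inv_power_times_conv_shift)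

lemma w_coeff_deriv: "w_coeff j (fps_deriv G) = fps_deriv (w_coeff j G)"
  by (rule fps_ext) (simp add: fls_of_nat distrib_right)

definition D_K :: "rat fls fps \<Rightarrow> rat fls fps" where
  "D_K G = fps_X * fps_deriv G"

lemma D_K_nth: "D_K G $ d = of_nat d * G $ d"
  by (cases d) (simp_all add: D_K_def del: of_nat_Suc)

lemma w_coeff_D_K: "w_coeff j (D_K G) = D_op (w_coeff j G)"
proof (rule fps_ext)
  fix d show "w_coeff j (D_K G) $ d = D_op (w_coeff j G) $ d"
    by (cases d) (simp_all add: D_op_def D_K_nth fls_of_nat del: of_nat_Suc)
qed

lemma w_coeff_D_K_power: "w_coeff j ((D_K ^^ i) G) = (D_op ^^ i) (w_coeff j G)"
  by (induction i) (simp_all add: w_coeff_D_K)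

section \<open>The series \<open>L\<close> and the derivation rings built from it\<close>

lemma L_series_nth_0 [simp]: "L_series n $ 0 = 1"
  by (simp add: L_series_def)

lemma L_series_power:
  assumes "n > 0"
  shows "L_series n ^ n * (1 - fps_const (of_nat n ^ n) * fps_X) = 1"
proof -
  let ?c = "fps_const (- (of_nat n ^ n)) * fps_X :: rat fps"
  have "L_series n ^ n = fps_binomial (- 1 / of_nat n) ^ n oo ?c"
    unfolding L_series_def by (subst fps_compose_power) simp_all
  also have "fps_binomial (- 1 / of_nat n) ^ n = inverse (1 + fps_X :: rat fps)"
    using assms by (simp add: fps_binomial_power fps_binomial_minus_one)
  finally have "L_series n ^ n * ((1 + fps_X) oo ?c) = (inverse (1 + fps_X) * (1 + fps_X)) oo ?c"
    by (subst fps_compose_mult_distrib) simp_all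
  also have "inverse (1 + fps_X) * (1 + fps_X) = (1 :: rat fps)"
    by (rule inverse_mult_eq_1) simp
  also have "(1 + fps_X) oo ?c = 1 - fps_const (of_nat n ^ n) * fps_X"
    by (simp add: fps_compose_add_distrib flip: fps_const_neg)
  finally show ?thesis by simp
qed

text \<open>Obtained by differentiating \<open>L^n M = 1\<close> with \<open>M = 1 - n^n x\<close>;
  the same relation gives \<open>n^n x L^n = L^n - 1\<close>, which removes \<open>x\<close> from
  the result.\<close>

lemma D_op_L_series:
  assumes "n > 0"
  shows "D_op (L_series n) = fps_const (1 / of_nat n) * L_series n * (L_series n ^ n - 1)"
proof -
  define L where "L = L_series n"
  define c where "c = fps_const (of_nat n ^ n :: rat)"
  define M where "M = 1 - c * fps_X"
  have LM: "L ^ n * M = 1" using L_series_power[OF assms] by (simp add: L_def M_def c_def)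
  have dM: "fps_deriv M = - c" by (simp add: M_def c_def)
  have Ln: "L ^ (n - 1) * L = L ^ n" using assms by (metis Suc_pred' power_Suc2)
  have "fps_deriv (L ^ n * M) = 0" by (simp add: LM)
  then have "of_nat n * L ^ (n - 1) * fps_deriv L * M = c * L ^ n"
    by (simp add: fps_deriv_power dM fps_of_nat algebra_simps)
  then have "(of_nat n * L ^ (n - 1) * fps_deriv L * M) * L = c * L ^ n * L" by simp
  then have "of_nat n * fps_deriv L * (L ^ n * M) = c * L ^ n * L"
    unfolding Ln[symmetric] by (simp add: algebra_simps)
  then have 1: "of_nat n * fps_deriv L = c * L ^ n * L" by (simp add: LM)
  have "L ^ n - 1 = L ^ n - L ^ n * M" by (simp add: LM)
  also have "\<dots> = c * fps_X * L ^ n" by (simp add: M_def algebra_simps)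
  finally have 2: "L ^ n - 1 = c * fps_X * L ^ n" .
  have "fps_X * (of_nat n * fps_deriv L) = L * (L ^ n - 1)"
    unfolding 1 2 by (simp only: mult_ac)
  then have "fps_const (1 / of_nat n) * (fps_X * (of_nat n * fps_deriv L)) = fps_const (1 / of_nat n) * (L * (L ^ n - 1))"
    by simp
  then have "fps_const (1 / of_nat n) * of_nat n * (fps_X * fps_deriv L) = fps_const (1 / of_nat n) * L * (L ^ n - 1)"
    by (simp only: mult_ac)
  moreover have "fps_const (1 / of_nat n) * of_nat n = (1 :: rat fps)"
    using assms by (simp flip: fps_of_nat)
  ultimately show ?thesis by (simp add: D_op_def L_def)
qed

lemma D_op_mult: "D_op (f * g) = D_op f * g + f * D_op g"
  by (simp add: D_op_def algebra_simps)

lemma D_op_add: "D_op (f + g) = D_op f + D_op g"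
  by (simp add: D_op_def algebra_simps)

lemma D_op_const_mult: "D_op (fps_const c * g) = fps_const c * D_op g"
  by (simp add: D_op_def algebra_simps)

lemma D_op_power_L:
  assumes "n > 0"
  shows "D_op (L_series n ^ k) = fps_const (of_nat k / of_nat n) * L_series n ^ k * (L_series n ^ n - 1)"
proof (induction k)
  case 0
  show ?case by (simp add: D_op_def)
next
  case (Suc k)
  have "fps_const (of_nat (Suc k) / of_nat n) = fps_const (1 / of_nat n) + fps_const (of_nat k / of_nat n :: rat)"
    by (simp add: add_divide_distrib)
  then show ?case
    unfolding power_Suc D_op_mult Suc D_op_L_series[OF assms] by (simp only: algebra_simps)
qed

lemma derivation_algebra_fps:
  assumes "n > 0"
  shows "derivation_algebra fps_const (L_series n ^ n) D_op (L_series n) n"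
proof unfold_locales
  show "D_op (L_series n ^ n) = L_series n ^ n * (L_series n ^ n - 1)"
    using D_op_power_L[OF assms, of n] assms by simp
  show "D_op (L_series n) = fps_const (1 / of_nat n) * L_series n * (L_series n ^ n - 1)"
    by (rule D_op_L_series[OF assms])
qed (simp_all add: D_op_add D_op_mult, simp_all add: D_op_def)

text \<open>Here \<open>y = w L\<close>. As \<open>w\<close> is constant for the derivation, it
  obeys the same rule as \<open>L\<close>.\<close>

lemma derivation_algebra_K:
  assumes "n > 0"
  shows "derivation_algebra (\<lambda>c. fps_const (fls_const c)) (lift (L_series n ^ n)) D_K
           (fps_const fls_X_inv * lift (L_series n)) n"
proof unfold_locales
  have lift_D: "D_K (lift u) = lift (D_op u)" for u
  proof -
    have "lift fps_X = fps_X" by (rule fps_ext) simp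
    then show ?thesis by (simp add: D_K_def D_op_def lift_mult lift_deriv)
  qed
  have lc: "fps_const (fls_const c) = lift (fps_const c)" for c
    by (rule fps_ext) simp
  show "D_K (lift (L_series n ^ n)) = lift (L_series n ^ n) * (lift (L_series n ^ n) - 1)"
    using D_op_power_L[OF assms, of n] assms by (simp add: lift_D lift_mult lift_diff)
  have "D_K (fps_const fls_X_inv * lift (L_series n)) = fps_const fls_X_inv * D_K (lift (L_series n))"
    by (simp add: D_K_def algebra_simps)
  also have "\<dots> = fps_const fls_X_inv * lift (fps_const (1 / of_nat n) * L_series n * (L_series n ^ n - 1))"
    by (simp add: lift_D D_op_L_series[OF assms])
  finally show "D_K (fps_const fls_X_inv * lift (L_series n)) =
      fps_const (fls_const (1 / of_nat n)) * (fps_const fls_X_inv * lift (L_series n)) * (lift (L_series n ^ n) - 1)"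
    by (simp add: lift_mult lift_diff lc algebra_simps)
qed (simp_all add: D_K_def algebra_simps fls_plus_const fls_const_mult_const)

section \<open>Solutions of the differential equations give the asymptotic expansion\<close>

lemma Lop_eq:
  assumes "n > 0"
  shows "Lop n k f = (\<Sum>i\<le>k. poly_fps (A_coeff n k i) (L_series n ^ n) * (D_op ^^ i) f)"
proof -
  interpret derivation_algebra fps_const "L_series n ^ n" D_op "L_series n" n
    by (rule derivation_algebra_fps[OF assms])
  have "ev [:-1, 1:] = L_series n ^ n - 1"
    by (simp add: ev_pCons flip: fps_const_neg)
  moreover have "poly_fps p (L_series n ^ n) = ev p" for p
    by (simp add: poly_fps_def ev_def)
  ultimately show ?thesis
    by (simp only: Lop_def A_coeff_def ev_diff ev_mult ev_sum ev_smult ev_of_nat atMost_atLeast0)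
qed

lemma Lop_0 [simp]: "n > 0 \<Longrightarrow> Lop n k 0 = 0"
proof -
  assume "n > 0"
  moreover have "(D_op ^^ i) 0 = 0" for i
    by (induction i) (auto simp: D_op_def)
  ultimately show ?thesis by (simp add: Lop_eq)
qed

text \<open>The series with coefficient \<open>f s\<close> at \<open>w^(-s)\<close>, arranged by
  powers of \<open>x\<close> so as to live in the same ring as the expansion of \<open>F\<close>.
  Each coefficient in \<open>x\<close> may contain infinitely many powers of
  \<open>1/w\<close>.\<close>

definition w_gen :: "(nat \<Rightarrow> rat fps) \<Rightarrow> rat fls fps" where
  "w_gen f = Abs_fps (\<lambda>d. fps_to_fls (Abs_fps (\<lambda>s. f s $ d)))"

lemma w_coeff_w_gen: "w_coeff j (w_gen f) = (if j < 0 then 0 else f (nat j))"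
  by (rule fps_ext) (simp add: w_gen_def)

lemma w_gen_nth_0: "(\<And>s. f s $ 0 = (if s = 0 then 1 else 0)) \<Longrightarrow> w_gen f $ 0 = 1"
  by (rule fls_eqI) (simp add: w_gen_def)

lemma range_fps_to_fls_add:
  "a \<in> range fps_to_fls \<Longrightarrow> b \<in> range fps_to_fls \<Longrightarrow> a + b \<in> range (fps_to_fls :: rat fps \<Rightarrow> _)"
  by (auto simp flip: fps_to_fls_plus)

lemma range_fps_to_fls_diff:
  "a \<in> range fps_to_fls \<Longrightarrow> b \<in> range fps_to_fls \<Longrightarrow> a - b \<in> range (fps_to_fls :: rat fps \<Rightarrow> _)"
  by (auto simp flip: fps_to_fls_minus)

lemma range_fps_to_fls_mult:
  "a \<in> range fps_to_fls \<Longrightarrow> b \<in> range fps_to_fls \<Longrightarrow> a * b \<in> range (fps_to_fls :: rat fps \<Rightarrow> _)"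
  by (auto simp flip: fls_times_fps_to_fls)

lemma range_fps_to_fls_sum:
  "(\<And>i. i \<in> A \<Longrightarrow> a i \<in> range fps_to_fls) \<Longrightarrow> sum a A \<in> range (fps_to_fls :: rat fps \<Rightarrow> _)"
proof (induction A rule: infinite_finite_induct)
  case (insert x F)
  then show ?case by (simp add: range_fps_to_fls_add)
qed (use rangeI[of fps_to_fls 0] in auto)

text \<open>As \<open>P\<close> has constant term 1, the coefficients of \<open>Q\<close> arise from
  those of \<open>P\<close> and \<open>R\<close> by ring operations, and
  \<open>range fps_to_fls\<close> is a ring. Intended for the logarithmic derivative of
  \<open>P\<close>.\<close>

lemma quotient_no_w_powers:
  fixes P Q R :: "rat fls fps"
  assumes "P * Q = R" "P $ 0 = 1"
    and "\<And>d. P $ d \<in> range fps_to_fls" "\<And>d. R $ d \<in> range fps_to_fls"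
  shows "Q $ d \<in> range fps_to_fls"
proof (induction d rule: less_induct)
  case (less d)
  have "R $ d = Q $ d + (\<Sum>i=1..d. P $ i * Q $ (d - i))"
    unfolding assms(1)[symmetric] fps_mult_nth by (subst sum.atLeast_Suc_atMost) (simp_all add: assms(2))
  then have "Q $ d = R $ d - (\<Sum>i=1..d. P $ i * Q $ (d - i))" by simp
  also have "\<dots> \<in> range fps_to_fls"
    using less by (intro range_fps_to_fls_diff range_fps_to_fls_sum range_fps_to_fls_mult assms) auto
  finally show ?case .
qed

text \<open>The exponent is left free, since \<open>mu n\<close> is identified only later, in
  \<open>mu_eq\<close>.\<close>

definition exp_w :: "rat fps \<Rightarrow> ratfun fps" where
  "exp_w m = fps_compose (fps_exp w_var) (Abs_fps (\<lambda>d. to_fract [:m $ d:]))"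

lemma exp_w_nth_0: "exp_w m $ 0 = 1"
  by (simp add: exp_w_def)

lemma expand_exp_w_deriv:
  assumes "m $ 0 = 0"
  shows "fps_deriv (expand_fps (exp_w m)) =
           fps_const fls_X_inv * lift (fps_deriv m) * expand_fps (exp_w m)"
proof -
  define M where "M = Abs_fps (\<lambda>d. to_fract [:m $ d:])"
  have "M $ 0 = 0" using assms by (simp add: M_def)
  then have "fps_deriv (exp_w m) = fps_const w_var * exp_w m * fps_deriv M"
    by (simp add: exp_w_def fps_compose_deriv fps_compose_mult_distrib flip: M_def)
  moreover have "expand_fps M = lift m"
    by (rule fps_ext) (simp add: M_def expand_to_fract at_inf.ev_pCons)
  ultimately show ?thesis
    by (simp add: expand_fps_mult expand_fps_const expand_w_var lift_deriv mult_ac flip: expand_fps_deriv)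
      (simp add: expand_fps_mult expand_fps_const expand_w_var expand_fps_deriv mult_ac)
qed

section \<open>Coefficient recursion and logarithmic derivative of \<open>F\<close>\<close>

lemma hyper_F_Suc:
  assumes "n > 0"
  shows "hyper_F n $ Suc d * ((w_var + of_nat (Suc d)) ^ n - w_var ^ n) =
           hyper_F n $ d * (\<Prod>j=1..n. of_nat n * w_var + of_nat (n * d + j))"
proof -
  have nz: "(w_var + of_nat r) ^ n - w_var ^ n \<noteq> 0" if "r > 0" for r
  proof
    assume *: "(w_var + of_nat r) ^ n - w_var ^ n = 0"
    have of_nat: "to_fract (of_nat k) = of_nat k" for k
      by (induction k) (simp_all add: to_fract_add)
    have power: "to_fract (p ^ k) = to_fract p ^ k" for p :: "rat poly" and k
      by (induction k) (simp_all add: to_fract_mult)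
    have "to_fract (([:0, 1:] + of_nat r) ^ n - [:0, 1:] ^ n :: rat poly) = 0"
      using * unfolding w_var_def by (simp only: to_fract_add to_fract_diff power of_nat)
    \<comment> \<open>At \<open>w = 0\<close> this difference takes the value \<open>r^n\<close>,
      which is non-zero.\<close>
    then have "poly (([:0, 1:] + of_nat r) ^ n - [:0, 1:] ^ n) (0 :: rat) = 0"
      by (simp only: to_fract_eq_0_iff poly_0)
    then show False using that assms by (simp add: poly_power zero_power)
  qed
  have "(\<Prod>r=1..n * Suc d. of_nat n * w_var + of_nat r) =
      (\<Prod>r=1..n * d. of_nat n * w_var + of_nat r) * (\<Prod>r=n * d + 1..n * d + n. of_nat n * w_var + of_nat r)"
    by (subst prod.ub_add_nat[symmetric]) (simp_all add: add.commute)
  also have "(\<Prod>r=n * d + 1..n * d + n. of_nat n * w_var + of_nat r) = (\<Prod>j=1..n. of_nat n * w_var + of_nat (n * d + j))"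
    using prod.shift_bounds_cl_nat_ivl[of "\<lambda>r. of_nat n * w_var + of_nat r" 1 "n * d" n]
    by (simp add: add.commute)
  finally have "hyper_F n $ Suc d = hyper_F n $ d * (\<Prod>j=1..n. of_nat n * w_var + of_nat (n * d + j)) /
     ((w_var + of_nat (Suc d)) ^ n - w_var ^ n)"
    unfolding hyper_F_def by simp
  then show ?thesis using nz[of "Suc d"] by simp
qed

lemma hyper_F_nth_0: "hyper_F n $ 0 = 1"
  by (simp add: hyper_F_def)

lemma log_F_deriv: "hyper_F n * fps_deriv (log_F n) = fps_deriv (hyper_F n)"
proof -
  define G where "G = hyper_F n - 1"
  have G0: "G $ 0 = 0" by (simp add: G_def hyper_F_nth_0)
  have F: "hyper_F n = (1 + fps_X) oo G"
    using G0 by (simp add: fps_compose_add_distrib) (simp add: G_def)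
  have "fps_deriv (log_F n) = ((fps_deriv (fps_ln 1)) oo G) * fps_deriv G"
    by (simp only: log_F_def G_def[symmetric] fps_compose_deriv[OF G0])
  then have "hyper_F n * fps_deriv (log_F n) =
     ((1 + fps_X) oo G) * (((fps_deriv (fps_ln 1)) oo G) * fps_deriv G)"
    using F by simp
  also have "\<dots> = (((1 + fps_X) * fps_deriv (fps_ln 1)) oo G) * fps_deriv G"
    by (simp add: fps_compose_mult_distrib[OF G0] mult.assoc)
  also have "(1 + fps_X) * fps_deriv (fps_ln 1) = (1 :: ratfun fps)"
    by (simp add: fps_ln_deriv inverse_mult_eq_1')
  finally show ?thesis by (simp add: G_def)
qed

text \<open>An arbitrary normalized solution. Its identification with \<open>Phi n\<close> yields
  uniqueness, and, applied to a constructed solution, the fact that \<open>Phi n\<close> solves the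
  system.\<close>

locale ode_solution =
  fixes n :: nat and f :: "nat \<Rightarrow> rat fps"
  assumes n_pos: "n > 0" and ode: "\<And>s. satisfies_ODE n f s"
    and init: "\<And>s. f s $ 0 = (if s = 0 then 1 else 0)"
begin

abbreviation "L \<equiv> L_series n"
abbreviation "W \<equiv> fps_const (fls_X_inv :: rat fls)"

sublocale K: derivation_algebra "\<lambda>c. fps_const (fls_const c)" "lift (L ^ n)" D_K "W * lift L" n
  by (rule derivation_algebra_K[OF n_pos])

definition "P = w_gen f"

lemma K_ev: "K.ev p = lift (poly_fps p (L ^ n))"
proof -
  interpret derivation_algebra fps_const "L ^ n" D_op L n
    by (rule derivation_algebra_fps[OF n_pos])
  have const: "lift (fps_const c) = fps_const (fls_const c)" for c
    by (rule fps_ext) simp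
  have "K.ev p = lift (ev p)"
    by (induction p) (simp_all add: K.ev_pCons ev_pCons lift_add lift_mult const)
  then show ?thesis by (simp add: ev_def poly_fps_def)
qed

text \<open>The whole system in one equation: its coefficient of \<open>w^(-j)\<close> is
  \<open>L^(n-1)\<close> times the ODE of index \<open>s = j + n - 1\<close>. For negative
  \<open>j + n - 1\<close> only coefficients of positive powers of \<open>w\<close> in
  \<open>P\<close> occur, and these vanish.\<close>

lemma operator_P: "(\<Sum>k=1..n. (W * lift L) ^ (n - k) * (\<Sum>i\<le>k. K.ev (A_coeff n k i) * (D_K ^^ i) P)) = 0"
proof (rule w_coeff_eqI)
  fix j :: int
  have "w_coeff j (\<Sum>k=1..n. (W * lift L) ^ (n - k) * (\<Sum>i\<le>k. K.ev (A_coeff n k i) * (D_K ^^ i) P)) =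
    (\<Sum>k=1..n. L ^ (n - k) * Lop n k (w_coeff (j + int (n - k)) P))"
    by (simp only: w_coeff_sum power_mult_distrib mult.assoc w_coeff_w_power_mult K_ev Lop_eq[OF n_pos]
        w_coeff_D_K_power w_coeff_lift_mult lift_power[symmetric])
  also have "\<dots> = 0"
  proof (cases "j + int n - 1 < 0")
    case True
    then have "w_coeff (j + int (n - k)) P = 0" if "k \<in> {1..n}" for k
      using that by (simp add: P_def w_coeff_w_gen)
    then show ?thesis using n_pos by simp
  next
    case False
    define s where "s = nat (j + int n - 1)"
    have Linv: "inverse L * L = 1" by (rule inverse_mult_eq_1) simp
    have "(\<Sum>k=1..n. L ^ (n - k) * Lop n k (w_coeff (j + int (n - k)) P)) =
       (\<Sum>k=1..n. L ^ (n - 1) * (inverse L ^ (k - 1) * Lop n k (if k \<le> s + 1 then f (s + 1 - k) else 0)))"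
    proof (rule sum.cong[OF refl])
      fix k assume k: "k \<in> {1..n}"
      have "L ^ (n - 1) = L ^ (n - k) * L ^ (k - 1)"
        using k by (simp flip: power_add)
      then have "L ^ (n - 1) * inverse L ^ (k - 1) = L ^ (n - k) * (inverse L * L) ^ (k - 1)"
        by (simp add: power_mult_distrib)
      then have 1: "L ^ (n - 1) * inverse L ^ (k - 1) = L ^ (n - k)" by (simp add: Linv)
      have 2: "w_coeff (j + int (n - k)) P = (if k \<le> s + 1 then f (s + 1 - k) else 0)"
      proof -
        have "j + int (n - k) < 0 \<longleftrightarrow> \<not> k \<le> s + 1" and "nat (j + int (n - k)) = s + 1 - k"
          using k False by (auto simp: s_def of_nat_diff nat_diff_distrib')
        then show ?thesis by (simp add: P_def w_coeff_w_gen)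
      qed
      show "L ^ (n - k) * Lop n k (w_coeff (j + int (n - k)) P) = L ^ (n - 1) *
         (inverse L ^ (k - 1) * Lop n k (if k \<le> s + 1 then f (s + 1 - k) else 0))"
        unfolding 2 mult.assoc[symmetric] 1 ..
    qed
    also have "\<dots> = L ^ (n - 1) * 0"
      using ode[of s] unfolding satisfies_ODE_def by (simp flip: sum_distrib_left)
    finally show ?thesis by simp
  qed
  finally show "w_coeff j (\<Sum>k=1..n. (W * lift L) ^ (n - k) * (\<Sum>i\<le>k. K.ev (A_coeff n k i) * (D_K ^^ i) P)) = w_coeff j 0"
    by simp
qed

text \<open>Adding \<open>(L^n - 1) Dy^n P\<close> to both sides completes the sum over
  \<open>r \<ge> 1\<close> to the full product, because \<open>S_sym 0 n = 1\<close>.\<close>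

lemma operator_P': "lift (L ^ n) * (K.Dy ^^ n) P - (W * lift L) ^ n * P = (lift (L ^ n) - 1) * K.Dy_prod n P"
proof -
  define U S where "U = (K.Dy ^^ n) P"
    and "S = (\<Sum>r=1..n. fps_const (fls_const (of_nat (S_sym r n) / of_nat n ^ r)) * (K.Dy ^^ (n - r)) P)"
  have "K.Dy_prod n P = U + S"
    unfolding K.Dy_prod_expand atMost_atLeast0 U_def S_def by (subst sum.atLeast_Suc_atMost) simp_all
  moreover have "U - (W * lift L) ^ n * P = (lift (L ^ n) - 1) * S"
    using K.operator_expand[of P] unfolding operator_P U_def S_def by simp
  moreover have "lift (L ^ n) * U - (W * lift L) ^ n * P = (lift (L ^ n) - 1) * U + (U - (W * lift L) ^ n * P)"
    by (simp add: left_diff_distrib)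
  ultimately show ?thesis unfolding U_def[symmetric] by (simp only: distrib_left)
qed

text \<open>The antiderivative of \<open>(L - 1) / x\<close>, that is, the solution of
  \<open>1 + D mu = L\<close> without constant term.\<close>

definition "mu0 = fps_integral0 (Abs_fps (\<lambda>d. L $ Suc d))"

lemma mu0_0: "mu0 $ 0 = 0" by (simp add: mu0_def)

lemma D_op_mu0: "1 + D_op mu0 = L"
proof (rule fps_ext)
  fix d show "(1 + D_op mu0) $ d = L $ d"
    by (cases d) (simp_all add: D_op_def mu0_def fps_deriv_fps_integral)
qed

definition "Y = expand_fps (exp_w mu0)"

lemma Y_0: "Y $ 0 = 1"
  by (simp add: Y_def exp_w_nth_0)

lemma Y_deriv: "fps_deriv Y = W * lift (fps_deriv mu0) * Y"
  unfolding Y_def by (rule expand_exp_w_deriv[of mu0, OF mu0_0])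

definition "Dw G = D_K G + W * G"

lemma Dw_Y: "Dw (Y * G) = Y * K.Dy G"
proof -
  have X: "lift fps_X = fps_X" by (rule fps_ext) simp
  have "D_K Y = W * lift (D_op mu0) * Y"
    unfolding D_K_def Y_deriv by (simp add: D_op_def lift_mult X mult_ac)
  then have "Dw (Y * G) = Y * (D_K G + W * (1 + lift (D_op mu0)) * G)"
    by (simp add: Dw_def K.D_mult algebra_simps)
  also have "1 + lift (D_op mu0) = lift L"
    using arg_cong[OF D_op_mu0, of lift] by (simp add: lift_add)
  finally show ?thesis by (simp add: K.Dy_def)
qed

lemma Dw_power_Y: "(Dw ^^ k) (Y * G) = Y * (K.Dy ^^ k) G"
  by (induction k) (simp_all add: Dw_Y)

primrec Dw_prod :: "nat \<Rightarrow> rat fls fps \<Rightarrow> rat fls fps" where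
  "Dw_prod 0 G = G"
| "Dw_prod (Suc N) G = Dw (Dw_prod N G) + fps_const (fls_const (of_nat (Suc N) / of_nat n)) * Dw_prod N G"

lemma Dw_prod_Y: "Dw_prod N (Y * G) = Y * K.Dy_prod N G"
  by (induction N) (simp_all add: Dw_Y algebra_simps)

lemma Dw_nth: "Dw G $ d = (fls_X_inv + of_nat d) * G $ d"
  by (simp add: Dw_def D_K_nth algebra_simps)

lemma Dw_power_nth: "(Dw ^^ k) G $ d = (fls_X_inv + of_nat d) ^ k * G $ d"
  by (induction k) (simp_all add: Dw_nth mult_ac)

text \<open>On \<open>x^d\<close> the factor \<open>D + w + j/n\<close> multiplies by
  \<open>w + d + j/n\<close>, and \<open>n\<close> times this is a factor of the recursion for
  \<open>F\<close>. Clearing these denominators for \<open>N = n\<close> produces the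
  \<open>n^n\<close> in \<open>L\<close>.\<close>

lemma Dw_prod_nth:
  "of_nat n ^ N * Dw_prod N G $ d = (\<Prod>j=1..N. of_nat n * fls_X_inv + of_nat (n * d + j)) * G $ d"
proof (induction N)
  case (Suc N)
  define c :: "rat fls" where "c = fls_const (of_nat (Suc N) / of_nat n)"
  define H where "H = Dw_prod N G $ d"
  have c: "of_nat n * c = of_nat (Suc N)"
    using n_pos by (simp add: c_def fls_of_nat fls_const_mult_const del: of_nat_Suc)
  have "Dw_prod (Suc N) G $ d = (fls_X_inv + of_nat d) * H + c * H"
    by (simp add: Dw_nth c_def H_def)
  then have "of_nat n * Dw_prod (Suc N) G $ d = of_nat n * ((fls_X_inv + of_nat d) * H) + (of_nat n * c) * H"
    by (simp only: distrib_left mult.assoc)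
  also have "\<dots> = (of_nat n * fls_X_inv + of_nat (n * d + Suc N)) * H"
    unfolding c by (simp add: algebra_simps)
  finally have "of_nat n * Dw_prod (Suc N) G $ d = (of_nat n * fls_X_inv + of_nat (n * d + Suc N)) * Dw_prod N G $ d"
    by (simp only: H_def)
  then have "of_nat n ^ Suc N * Dw_prod (Suc N) G $ d =
     (of_nat n * fls_X_inv + of_nat (n * d + Suc N)) * (of_nat n ^ N * Dw_prod N G $ d)"
    by (simp add: mult_ac)
  then show ?case unfolding Suc by (simp add: mult_ac)
qed simp

lemma P_0: "P $ 0 = 1"
  unfolding P_def by (rule w_gen_nth_0) (rule init)

text \<open>Conjugating back and multiplying by \<open>1 - n^n x\<close>, the inverse of
  \<open>L^n\<close>, turns the equation for \<open>P\<close> into the coefficient recursion of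
  \<open>F\<close>; both sides have constant term 1.\<close>

lemma expand_hyper_F: "expand_fps (hyper_F n) = Y * P"
proof -
  define G where "G = Y * P"
  have "lift (L ^ n) * (Dw ^^ n) G - W ^ n * lift (L ^ n) * G = (lift (L ^ n) - 1) * Dw_prod n G"
    using arg_cong[OF operator_P', of "\<lambda>H. Y * H"]
    unfolding G_def Dw_power_Y Dw_prod_Y by (simp add: power_mult_distrib lift_power algebra_simps)
  then have eq: "lift (L ^ n) * ((Dw ^^ n) G - W ^ n * G) = (lift (L ^ n) - 1) * Dw_prod n G"
    by (simp add: algebra_simps)
  define M :: "rat fps" where "M = 1 - fps_const (of_nat n ^ n) * fps_X"
  have LM: "L ^ n * M = 1" using L_series_power[OF n_pos] by (simp add: M_def)
  have "lift (L ^ n * M) * ((Dw ^^ n) G - W ^ n * G) = lift M * (lift (L ^ n) * ((Dw ^^ n) G - W ^ n * G))"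
    by (simp add: lift_mult mult_ac)
  also have "\<dots> = (lift (L ^ n * M) - lift M) * Dw_prod n G"
    unfolding eq by (simp add: lift_mult algebra_simps)
  also have "lift (L ^ n * M) - lift M = fps_const (of_nat n ^ n) * fps_X"
  proof -
    have "lift (fps_const (of_nat n ^ n) * fps_X) = fps_const (of_nat n ^ n) * fps_X"
    proof (rule fps_ext)
      have "fls_const (of_nat n ^ n) = (of_nat n ^ n :: rat fls)"
        by (simp add: fls_of_nat fls_const_power)
      then show "lift (fps_const (of_nat n ^ n) * fps_X) $ d = (fps_const (of_nat n ^ n) * fps_X) $ d" for d
        by simp
    qed
    then show ?thesis unfolding LM by (simp add: M_def lift_diff)
  qed
  finally have main: "(Dw ^^ n) G - W ^ n * G = fps_const (of_nat n ^ n) * (fps_X * Dw_prod n G)"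
    unfolding LM by (simp add: mult.assoc)
  have rec: "G $ Suc d * ((fls_X_inv + of_nat (Suc d)) ^ n - fls_X_inv ^ n) =
      G $ d * (\<Prod>j=1..n. of_nat n * fls_X_inv + of_nat (n * d + j))" for d
  proof -
    have "((Dw ^^ n) G - W ^ n * G) $ Suc d = of_nat n ^ n * Dw_prod n G $ d"
      unfolding main by simp
    then show ?thesis
      unfolding Dw_prod_nth by (simp add: Dw_power_nth fps_const_power algebra_simps)
  qed
  have "expand_fps (hyper_F n) $ d = G $ d" for d
  proof (induction d)
    case 0
    show ?case by (simp add: hyper_F_nth_0 G_def Y_0 P_0)
  next
    case (Suc d)
    have nz: "(fls_X_inv + of_nat (Suc d)) ^ n - fls_X_inv ^ n \<noteq> (0 :: rat fls)"
    proof
      let ?q = "[:of_nat (Suc d), 1:] ^ n - [:0, 1:] ^ n :: rat poly"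
      have power: "at_inf.ev (p ^ k) = at_inf.ev p ^ k" for p k
        by (induction k) (simp_all add: at_inf.ev_mult)
      assume "(fls_X_inv + of_nat (Suc d)) ^ n - fls_X_inv ^ n = (0 :: rat fls)"
      then have "at_inf.ev ?q = 0"
        by (simp add: at_inf.ev_diff power at_inf.ev_pCons fls_of_nat add.commute del: of_nat_Suc)
      then have "poly ?q 0 = 0" by (simp only: at_inf_ev_eq_0_iff poly_0)
      then show False using n_pos by (simp add: poly_power zero_power del: of_nat_Suc)
    qed
    have "expand_at_infinity (hyper_F n $ Suc d) * ((fls_X_inv + of_nat (Suc d)) ^ n - fls_X_inv ^ n) =
      G $ d * (\<Prod>j=1..n. of_nat n * fls_X_inv + of_nat (n * d + j))"
      using arg_cong[OF hyper_F_Suc[OF n_pos, of d], of expand_at_infinity] Suc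
      by (simp add: expand_mult expand_diff expand_add expand_power expand_of_nat expand_prod expand_w_var
         del: of_nat_Suc of_nat_add of_nat_mult)
    then show ?case using nz unfolding rec[symmetric] by simp
  qed
  then show ?thesis unfolding G_def by (rule fps_ext)
qed

text \<open>Logarithmic differentiation of \<open>F = Y P\<close> gives \<open>w mu0'\<close> plus
  the quotient of \<open>P'\<close> by \<open>P\<close>. That quotient has no positive powers of
  \<open>w\<close>, so the coefficient of \<open>w\<close> is \<open>mu0'\<close>.\<close>

lemma mu_eq: "mu n = mu0"
proof -
  define l where "l = expand_fps (log_F n)"
  define Q where "Q = fps_deriv l - W * lift (fps_deriv mu0)"
  have "Y * (P * fps_deriv l) = Y * (W * lift (fps_deriv mu0) * P + fps_deriv P)"
    using arg_cong[OF log_F_deriv, of expand_fps n]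
    by (simp add: expand_fps_mult expand_fps_deriv expand_hyper_F Y_deriv l_def algebra_simps)
  moreover have "Y \<noteq> 0" using Y_0 by (metis fps_zero_nth zero_neq_one)
  ultimately have "P * fps_deriv l = W * lift (fps_deriv mu0) * P + fps_deriv P" by simp
  then have PQ: "P * Q = fps_deriv P"
    by (simp add: Q_def algebra_simps)
  have Pr: "P $ d \<in> range fps_to_fls" for d
    by (simp add: P_def w_gen_def)
  have "fps_deriv P $ d \<in> range fps_to_fls" for d
  proof -
    have "of_nat (Suc d) \<in> range (fps_to_fls :: rat fps \<Rightarrow> _)"
      by (metis fps_to_fls_of_nat rangeI)
    then show ?thesis unfolding fps_deriv_nth Suc_eq_plus1[symmetric] using Pr by (rule range_fps_to_fls_mult)
  qed
  then have "Q $ d \<in> range fps_to_fls" for d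
    using quotient_no_w_powers[OF PQ P_0 Pr] by blast
  then have "Q $ d $$ (-1) = 0" for d
  proof -
    obtain h where "Q $ d = fps_to_fls h" using \<open>\<And>d. Q $ d \<in> range fps_to_fls\<close> by blast
    then show ?thesis by simp
  qed
  then have "w_coeff (-1) Q = 0" by (intro fps_ext) simp
  then have "fps_deriv (w_coeff (-1) l) = w_coeff (-1) (W ^ 1 * (lift (fps_deriv mu0) * 1))"
    by (simp add: Q_def w_coeff_diff w_coeff_deriv)
  also have "\<dots> = fps_deriv mu0 * w_coeff 0 1"
    unfolding w_coeff_w_power_mult w_coeff_lift_mult by simp
  also have "w_coeff 0 (1 :: rat fls fps) = 1" by (rule fps_ext) simp
  finally have "w_coeff (-1) l = fps_const (w_coeff (-1) l $ 0 - mu0 $ 0) + mu0"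
    by (simp add: fps_deriv_eq_iff)
  moreover have "w_coeff (-1) l $ 0 = 0" by (simp add: l_def log_F_def)
  ultimately have "w_coeff (-1) l = mu0" by (simp add: mu0_0)
  then show ?thesis by (simp add: mu_def coeff_at_infinity_eq l_def)
qed

theorem Phi_eq: "Phi n s = f s"
proof -
  have "exp_mu_w n = exp_w mu0"
    by (simp add: exp_mu_w_def exp_w_def mu_eq)
  then have "expand_fps (hyper_F n * inverse (exp_mu_w n)) = Y * P * inverse Y"
    by (simp add: expand_fps_mult expand_fps_inverse exp_w_nth_0 expand_hyper_F Y_def)
  also have "\<dots> = (Y * inverse Y) * P" by (simp add: mult_ac)
  also have "Y * inverse Y = 1" using Y_0 by (intro inverse_mult_eq_1') simp
  finally show ?thesis
    by (simp add: Phi_def coeff_at_infinity_eq P_def w_coeff_w_gen)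
qed

end

section \<open>The recursion for the homogeneous solution\<close>

text \<open>Lets the recursion sum over all \<open>k \<le> s + 1\<close> whatever \<open>n\<close>
  is, which keeps its shape independent of \<open>n\<close>.\<close>

lemma A_coeff_eq_0: "n < k \<Longrightarrow> i \<le> k \<Longrightarrow> A_coeff n k i = 0"
proof -
  assume k: "n < k" "i \<le> k"
  have 1: "of_nat (n choose i) * H_poly n (n - i) (k - i) = 0"
  proof (cases "i \<le> n")
    case True
    with k have "n - i < k - i" by simp
    then show ?thesis by (simp add: H_poly_eq_0)
  qed (simp add: binomial_eq_0)
  have 2: "smult (of_nat ((n - r) choose i) * (of_nat (S_sym r n) / of_nat n ^ r)) (H_poly n (n - i - r) (k - i - r)) = 0" for r
  proof (cases "i + r \<le> n")
    case True
    with k have "n - i - r < k - i - r" by simp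
    then show ?thesis by (simp add: H_poly_eq_0)
  next
    case False
    then show ?thesis by (cases "n < r") (simp_all add: S_sym_eq_0 binomial_eq_0)
  qed
  show ?thesis unfolding A_coeff_def 1 2 by simp
qed

lemma A_coeff_0_dvd: "k > 0 \<Longrightarrow> [:-1, 1:] dvd A_coeff n k 0"
  unfolding A_coeff_def using H_poly_dvd[of n n "k - 1"]
  by (intro dvd_diff[OF dvd_mult dvd_triv_left]) simp

lemma H_poly_1: "H_poly n m (Suc 0) = smult (of_nat m * (of_nat m - 1) / (2 * of_nat n)) [:-1, 1:]"
proof (induction m)
  case (Suc m)
  have 1: "[:0, 1:] - 1 = [:-1, 1 :: rat:]" by (simp add: one_pCons)
  have "H_poly n (Suc m) (Suc 0) = H_poly n m (Suc 0) + smult (of_nat m / of_nat n) [:-1, 1:]"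
    unfolding H_poly.simps 1 H_poly_0 by simp
  also have "\<dots> = smult (of_nat m * (of_nat m - 1) / (2 * of_nat n) + of_nat m / of_nat n) [:-1, 1:]"
    unfolding Suc smult_add_left ..
  also have "of_nat m * (of_nat m - 1) / (2 * of_nat n) + of_nat m / of_nat n =
      of_nat (Suc m) * (of_nat (Suc m) - 1) / (2 * of_nat n :: rat)"
    by (cases "n = 0") (simp_all add: field_simps)
  finally show ?case .
qed simp

lemma S_sym_1: "of_nat (S_sym (Suc 0) n) = (of_nat n * (of_nat n + 1) / 2 :: rat)"
  by (induction n) (simp_all add: S_sym_eq_0 S_sym_Suc field_simps)

text \<open>The constant is \<open>(n - 1)/2 - (n + 1)/2\<close>. Together with
  \<open>A_coeff_1_1\<close> it gives \<open>\<LL>\<^sub>1 = n D - (L^n - 1)\<close>, which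
  annihilates \<open>L\<close>; hence the leading power of \<open>L\<close> in the ansatz.\<close>

lemma A_coeff_1_0: "n > 0 \<Longrightarrow> A_coeff n 1 0 = - [:-1, 1:]"
proof -
  assume n: "n > 0"
  have "A_coeff n 1 0 = smult (of_nat n * (of_nat n - 1) / (2 * of_nat n) - of_nat n * (of_nat n + 1) / 2 / of_nat n) [:-1, 1:]"
    unfolding A_coeff_def by (simp add: H_poly_1 S_sym_1)
  also have "of_nat n * (of_nat n - 1) / (2 * of_nat n) - of_nat n * (of_nat n + 1) / 2 / of_nat n = (-1 :: rat)"
    using n by (simp add: field_simps)
  finally show ?thesis by simp
qed

lemma A_coeff_1_1: "A_coeff n 1 1 = of_nat n"
  by (simp add: A_coeff_def)

text \<open>The sum is the coefficient of \<open>y^(n - k + m + 1)\<close> after the operator with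
  \<open>X = 0\<close> is applied to \<open>y^(m+1)\<close>, an eigenvector of \<open>D\<close>. The
  result is divisible by \<open>y^(n+1)\<close>, whose exponent is larger when
  \<open>m < k\<close>.\<close>

lemma A_coeff_indicial:
  assumes n: "n > 0" and k: "1 \<le> k" "k \<le> n" and m: "m < k"
  shows "(\<Sum>i\<le>k. poly (A_coeff n k i) 0 * (- of_nat (Suc m) / of_nat n) ^ i) = 0"
proof -
  define y :: "rat poly" where "y = [:0, 1:]"
  define D where "D g = smult (- 1 / of_nat n) (y * pderiv g)" for g :: "rat poly"
  \<comment> \<open>With \<open>X = 0\<close> the rules reduce to \<open>D y = - y / n\<close>,
    realized by \<open>- (1/n) y d/dy\<close>.\<close>
  interpret derivation_algebra "\<lambda>c. [:c:]" 0 D y n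
    by unfold_locales
      (simp_all add: D_def pderiv_add pderiv_mult smult_add_right algebra_simps y_def pderiv_pCons one_pCons)
  have ev: "ev p = [:poly p 0:]" for p
    by (cases p) (simp add: ev_pCons)
  \<comment> \<open>Each further factor raises the order in \<open>y\<close> by one: its constant
    \<open>(N + 1)/n\<close> cancels the eigenvalue of \<open>D\<close> on \<open>y^(N+1)\<close>,
    and \<open>D h'\<close> is itself a multiple of \<open>y\<close>.\<close>
  have prod: "\<exists>h'. Dy_prod N (y * h) = y ^ Suc N * h'" for N h
  proof (induction N)
    case 0
    show ?case by (intro exI[of _ h]) simp
  next
    case (Suc N)
    then obtain h' where h': "Dy_prod N (y * h) = y ^ Suc N * h'" by blast
    define c where "c = [:of_nat (Suc N) / of_nat n :: rat:]"
    have Dy: "D (y ^ Suc N) = - (c * y ^ Suc N)"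
      unfolding D_y_power c_def by simp
    have "D (y ^ Suc N * h') + y * (y ^ Suc N * h') + c * (y ^ Suc N * h') = y ^ Suc N * (D h' + y * h')"
      unfolding D_mult Dy by (simp add: algebra_simps)
    also have "\<dots> = y ^ Suc (Suc N) * (smult (- 1 / of_nat n) (pderiv h') + h')"
      by (simp add: D_def algebra_simps)
    finally show ?case
      by (intro exI[of _ "smult (- 1 / of_nat n) (pderiv h') + h'"]) (simp only: Dy_prod.simps h' c_def Dy_def)
  qed
  define g where "g = y ^ Suc m"
  have Dg: "D g = smult (- of_nat (Suc m) / of_nat n) g"
    unfolding g_def D_y_power by (simp del: of_nat_Suc)
  have Dig: "(D ^^ i) g = smult ((- of_nat (Suc m) / of_nat n) ^ i) g" for i
  proof (induction i)
    case (Suc i)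
    have "D (smult c g) = smult c (D g)" for c
      by (simp add: D_def pderiv_smult mult.commute)
    then show ?case using Suc Dg by (simp add: mult.commute)
  qed simp
  define N where "N k = (\<Sum>i\<le>k. poly (A_coeff n k i) 0 * (- of_nat (Suc m) / of_nat n) ^ i)" for k
  \<comment> \<open>For \<open>X = 0\<close> the factor \<open>X - 1\<close> is \<open>-1\<close>,
    so the lower terms add up with the leading one to the full product.\<close>
  have "Dy_prod n g - y ^ n * g = (Dy ^^ n) g - y ^ n * g - (0 - 1) * (\<Sum>r=1..n. [:of_nat (S_sym r n) / of_nat n ^ r:] * (Dy ^^ (n - r)) g)"
    unfolding Dy_prod_expand atMost_atLeast0 by (subst sum.atLeast_Suc_atMost) simp_all
  also have "\<dots> = (\<Sum>k=1..n. y ^ (n - k) * (\<Sum>i\<le>k. ev (A_coeff n k i) * (D ^^ i) g))"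
    by (rule operator_expand)
  also have "\<dots> = (\<Sum>k=1..n. monom (N k) (n - k + Suc m))"
  proof (rule sum.cong[OF refl])
    fix k
    have "(\<Sum>i\<le>k. ev (A_coeff n k i) * (D ^^ i) g) = smult (N k) g"
      by (simp add: ev Dig N_def smult_sum mult.commute)
    then show "y ^ (n - k) * (\<Sum>i\<le>k. ev (A_coeff n k i) * (D ^^ i) g) = monom (N k) (n - k + Suc m)"
      by (simp add: g_def y_def monom_altdef power_add)
  qed
  finally have "coeff (Dy_prod n g - y ^ n * g) (n - k + Suc m) = (\<Sum>l=1..n. if n - l + Suc m = n - k + Suc m then N l else 0)"
    by (simp only: coeff_sum coeff_monom)
  also have "\<dots> = (\<Sum>l=1..n. if l = k then N l else 0)"
    using k by (intro sum.cong) auto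
  also have "\<dots> = N k" using k by simp
  finally have "N k = coeff (Dy_prod n g - y ^ n * g) (n - k + Suc m)" by simp
  also have "\<dots> = 0"
  proof -
    obtain h' where "Dy_prod n (y * y ^ m) = y ^ Suc n * h'" using prod by blast
    then have "Dy_prod n g - y ^ n * g = y ^ Suc n * (h' - y ^ m)"
      by (simp add: g_def algebra_simps)
    also have "y ^ Suc n = monom 1 (Suc n)" by (simp add: y_def monom_altdef)
    finally have eq: "Dy_prod n g - y ^ n * g = monom 1 (Suc n) * (h' - y ^ m)" .
    have "n - k + Suc m < Suc n" using m k by simp
    then show ?thesis unfolding eq by (simp only: coeff_monom_mult if_True)
  qed
  finally show ?thesis by (simp add: N_def)
qed

text \<open>The operators induced by \<open>D\<close> and \<open>\<LL>\<^sub>k\<close> on \<open>g \<mapsto> L^(1-r) g(L^n)\<close>.\<close>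

definition T_op :: "nat \<Rightarrow> nat \<Rightarrow> rat poly \<Rightarrow> rat poly" where
  "T_op n r g = [:-1, 1:] * (smult ((1 - of_nat r) / of_nat n) g + [:0, 1:] * pderiv g)"

definition B_op :: "nat \<Rightarrow> nat \<Rightarrow> nat \<Rightarrow> rat poly \<Rightarrow> rat poly" where
  "B_op n k r g = (\<Sum>i\<le>k. A_coeff n k i * (T_op n r ^^ i) g)"

lemma B_op_eq_0: "n < k \<Longrightarrow> B_op n k r g = 0"
  by (simp add: B_op_def A_coeff_eq_0)

lemma B_op_dvd:
  assumes "k > 0"
  shows "[:-1, 1:] dvd B_op n k r g"
  unfolding B_op_def
proof (rule dvd_sum)
  fix i
  show "[:-1, 1:] dvd A_coeff n k i * (T_op n r ^^ i) g"
  proof (cases i)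
    case 0
    then show ?thesis using A_coeff_0_dvd[OF assms, of n] by simp
  next
    case (Suc j)
    have "[:-1, 1:] dvd T_op n r h" for h unfolding T_op_def by (rule dvd_triv_left)
    then show ?thesis by (simp add: Suc del: mult_pCons_left)
  qed
qed

text \<open>The \<open>1\<close> in the exponent \<open>1 - r\<close> cancels the contribution of
  \<open>A_coeff n 1 0\<close>. What remains besides \<open>X - 1\<close> is diagonal on monomials,
  with eigenvalue \<open>n b - r\<close> on \<open>X^b\<close>.\<close>

lemma B_op_1:
  assumes "n > 0"
  shows "B_op n 1 r g = [:-1, 1:] * (smult (of_nat n) ([:0, 1:] * pderiv g) - smult (of_nat r) g)"
proof -
  have "B_op n 1 r g = - [:-1, 1:] * g + of_nat n * T_op n r g"
    using A_coeff_1_0[OF assms] A_coeff_1_1[of n] by (simp add: B_op_def)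
  also have "of_nat n * T_op n r g = [:-1, 1:] * (smult (1 - of_nat r) g + smult (of_nat n) ([:0, 1:] * pderiv g))"
    using assms by (simp add: T_op_def of_nat_poly smult_add_right)
  finally show ?thesis by (simp add: algebra_simps smult_diff_left)
qed

text \<open>Only the constant term \<open>-1\<close> of the factor \<open>X - 1\<close> acts on the
  lowest exponent, so there \<open>T_op\<close> is a scalar.\<close>

lemma coeff_T_op_low:
  assumes "\<And>c. c < b \<Longrightarrow> coeff g c = 0"
  shows "c < b \<Longrightarrow> coeff ((T_op n r ^^ i) g) c = 0"
    and "coeff ((T_op n r ^^ i) g) b = (- ((1 - of_nat r) / of_nat n + of_nat b)) ^ i * coeff g b"
proof (induction i arbitrary: c)
  case (Suc i)
  define h where "h = (T_op n r ^^ i) g"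
  define u where "u = smult ((1 - of_nat r) / of_nat n) h + [:0, 1:] * pderiv h"
  have u: "coeff u c = ((1 - of_nat r) / of_nat n + of_nat c) * coeff h c" for c
    by (cases c) (simp_all add: u_def coeff_pderiv algebra_simps)
  have h: "coeff h c = 0" if "c < b" for c using Suc.IH(1)[OF that] by (simp add: h_def)
  have "(T_op n r ^^ Suc i) g = [:-1, 1:] * u"
    by (simp only: funpow.simps comp_def T_op_def[of n r "(T_op n r ^^ i) g"] h_def u_def)
  then have T: "coeff ((T_op n r ^^ Suc i) g) c = (if c = 0 then 0 else coeff u (c - 1)) - coeff u c" for c
    by (cases c) simp_all
  show "coeff ((T_op n r ^^ Suc i) g) c = 0" if "c < b" for c
    unfolding T using that by (simp add: u h)
  show "coeff ((T_op n r ^^ Suc i) g) b = (- ((1 - of_nat r) / of_nat n + of_nat b)) ^ Suc i * coeff g b"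
  proof -
    have "coeff ((T_op n r ^^ Suc i) g) b = - coeff u b"
      unfolding T by (simp add: u h)
    also have "\<dots> = - ((1 - of_nat r) / of_nat n + of_nat b) * coeff h b"
      by (simp only: u minus_mult_left)
    finally show ?thesis using Suc.IH(2) by (simp add: h_def)
  qed
qed (use assms in auto)

lemma coeff_mult_low:
  assumes "\<And>c. c < b \<Longrightarrow> coeff g c = 0"
  shows "coeff (p * g) b = poly p 0 * coeff (g :: rat poly) b"
proof -
  have "coeff (p * g) b = (\<Sum>i\<le>b. coeff p i * coeff g (b - i))" by (rule coeff_mult)
  also have "\<dots> = (\<Sum>i\<le>b. if i = 0 then coeff p 0 * coeff g b else 0)"
    by (intro sum.cong refl) (auto intro!: assms)
  finally show ?thesis by (simp add: poly_0_coeff_0)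
qed

text \<open>For \<open>b\<close> with \<open>r \<le> n b\<close>, the term \<open>L^(1-r) X^b\<close> is \<open>L^(m+1)\<close> with \<open>m = n b - r\<close>, where the indicial
  polynomial of \<open>\<LL>\<^sub>k\<close> at \<open>L = 0\<close> vanishes for \<open>m < k\<close>.\<close>

lemma coeff_B_op_low:
  assumes n: "n > 0" and k: "1 \<le> k" "k \<le> n" and g: "\<And>c. n * c < r \<Longrightarrow> coeff g c = 0"
    and b: "n * b < r + k"
  shows "coeff (B_op n k r g) b = 0"
proof -
  have low: "coeff g c = 0" if "c < b" for c
  proof (rule g)
    \<comment> \<open>Because \<open>k \<le> n\<close>, every exponent below \<open>b\<close> falls
      under the vanishing hypothesis on \<open>g\<close>, so only the term \<open>X^b\<close>
      counts.\<close>
    have "n * Suc c \<le> n * b" using that by (intro mult_le_mono) auto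
    then show "n * c < r" using b k by simp
  qed
  define \<tau> where "\<tau> = - ((1 - of_nat r) / of_nat n + of_nat b :: rat)"
  have "coeff (A_coeff n k i * (T_op n r ^^ i) g) b = poly (A_coeff n k i) 0 * \<tau> ^ i * coeff g b" for i
    using coeff_mult_low[OF coeff_T_op_low(1)[OF low]] coeff_T_op_low(2)[OF low]
    by (simp add: \<tau>_def mult.assoc)
  then have eq: "coeff (B_op n k r g) b = (\<Sum>i\<le>k. poly (A_coeff n k i) 0 * \<tau> ^ i) * coeff g b"
    by (simp add: B_op_def coeff_sum sum_distrib_right)
  show ?thesis
  proof (cases "n * b < r")
    case False
    define m where "m = n * b - r"
    have m: "m < k" "n * b = m + r" using False b by (auto simp: m_def)
    then have "of_nat n * of_nat b = (of_nat m + of_nat r :: rat)" by (metis of_nat_add of_nat_mult)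
    then have "\<tau> = - of_nat (Suc m) / of_nat n"
      using n by (simp add: \<tau>_def field_simps)
    then show ?thesis using A_coeff_indicial[OF n k m(1)] eq by simp
  qed (simp add: eq g)
qed

definition Q_op :: "nat \<Rightarrow> nat \<Rightarrow> nat \<Rightarrow> rat poly \<Rightarrow> rat poly" where
  "Q_op n k r g = B_op n k r g div [:-1, 1:]"

lemma Q_op: "k > 0 \<Longrightarrow> [:-1, 1:] * Q_op n k r g = B_op n k r g"
  unfolding Q_op_def by (intro dvd_mult_div_cancel B_op_dvd)

text \<open>In \<open>(X - 1) Q\<close> the coefficient at \<open>b + 1\<close> is the difference of
  two neighbouring coefficients of \<open>Q\<close>, so vanishing spreads upwards from the constant
  term.\<close>

lemma coeff_Q_op_low:
  assumes "n > 0" "1 \<le> k" and g: "\<And>c. n * c < r \<Longrightarrow> coeff g c = 0"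
  shows "n * b < r + k \<Longrightarrow> coeff (Q_op n k r g) b = 0"
proof (cases "k \<le> n")
  case True
  assume "n * b < r + k"
  then show ?thesis
  proof (induction b)
    case 0
    have "coeff (B_op n k r g) 0 = 0" using coeff_B_op_low[OF assms(1,2) True g 0] .
    then show ?case using assms(2) by (simp flip: Q_op)
  next
    case (Suc b)
    have "coeff (B_op n k r g) (Suc b) = 0" using coeff_B_op_low[OF assms(1,2) True g Suc.prems] .
    moreover have "coeff (Q_op n k r g) b = 0" using Suc by simp
    ultimately show ?case using assms(2) by (simp flip: Q_op)
  qed
qed (simp add: Q_op_def B_op_eq_0)

lemma rational_poly_at_pos_Q_op:
  assumes "rational_poly_at_pos g" "k > 0"
  shows "rational_poly_at_pos (\<lambda>n. Q_op n k r (g n))"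
proof (rule rational_poly_at_pos_cancel)
  have T: "rational_poly_at_pos (\<lambda>n. T_op n r (h n))" if "rational_poly_at_pos h" for h
    unfolding T_op_def using that
    by (intro rational_poly_at_pos_mult rational_poly_at_pos_const rational_poly_at_pos_add rational_poly_at_pos_smult
        rational_poly_at_pos_pderiv rational_at_pos_div_of_nat rational_at_pos_const)
  have "rational_poly_at_pos (\<lambda>n. (T_op n r ^^ i) (g n))" for i
    by (induction i) (simp_all add: assms T)
  then have "rational_poly_at_pos (\<lambda>n. B_op n k r (g n))"
    unfolding B_op_def by (intro rational_poly_at_pos_sum rational_poly_at_pos_mult rational_poly_at_pos_A_coeff)
  then show "rational_poly_at_pos (\<lambda>n. [:-1, 1:] * Q_op n k r (g n))"
    unfolding Q_op[OF assms(2)] .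
qed

section \<open>The recursion and its solution\<close>

definition recursion_rhs :: "(nat \<Rightarrow> nat \<Rightarrow> rat poly) \<Rightarrow> nat \<Rightarrow> nat \<Rightarrow> rat poly" where
  "recursion_rhs F s n = - (\<Sum>k=2..s + 1. Q_op n k (s + 1 - k) (F (s + 1 - k) n))"

text \<open>\<open>g\<close> is a function of \<open>n\<close>, so that rational dependence is part
  of each step. The vanishing below \<open>s / n\<close> is carried along because later right-hand
  sides rely on it. For \<open>s = 0\<close> the equation leaves a constant free, and 1 is
  chosen.\<close>

definition recursion_step :: "(nat \<Rightarrow> nat \<Rightarrow> rat poly) \<Rightarrow> nat \<Rightarrow> (nat \<Rightarrow> rat poly) \<Rightarrow> bool" where
  "recursion_step F s g \<longleftrightarrow> rational_poly_at_pos g \<and>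
     (\<forall>n>0. (\<forall>b. n * b < s \<longrightarrow> coeff (g n) b = 0) \<and>
        smult (of_nat n) ([:0, 1:] * pderiv (g n)) - smult (of_nat s) (g n) = recursion_rhs F s n) \<and>
     (s = 0 \<longrightarrow> g = (\<lambda>n. 1))"

lemma recursion_step_ex:
  assumes "\<And>r. r < s \<Longrightarrow> recursion_step F r (F r)"
  shows "\<exists>g. recursion_step F s g"
proof (cases "s = 0")
  case True
  then have "recursion_step F s (\<lambda>n. 1)"
    by (simp add: recursion_step_def recursion_rhs_def rational_poly_at_pos_const)
  then show ?thesis by (rule exI[of _ "\<lambda>n. 1"])
next
  case False
  define p where "p = recursion_rhs F s"
  have F: "rational_poly_at_pos (F r)" "\<And>n b. n > 0 \<Longrightarrow> n * b < r \<Longrightarrow> coeff (F r n) b = 0" if "r < s" for r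
    using assms[OF that] by (simp_all add: recursion_step_def)
  have "rational_poly_at_pos (\<lambda>n. \<Sum>k=2..s + 1. Q_op n k (s + 1 - k) (F (s + 1 - k) n))"
    using False by (intro rational_poly_at_pos_sum rational_poly_at_pos_Q_op F) auto
  then have p: "rational_poly_at_pos p"
    unfolding p_def recursion_rhs_def[abs_def]
    using rational_poly_at_pos_diff[OF rational_poly_at_pos_const[of 0]] by simp
  \<comment> \<open>With \<open>r = s + 1 - k\<close> the bound \<open>n b < r + k\<close> reads
    \<open>n b \<le> s\<close>. It covers the resonant exponent \<open>n b = s\<close>, needed for
    the division, and the smaller ones, needed to continue.\<close>
  have p_low: "coeff (p n) b = 0" if "n > 0" "n * b \<le> s" for n b
  proof -
    have "coeff (Q_op n k (s + 1 - k) (F (s + 1 - k) n)) b = 0" if "k \<in> {2..s + 1}" for k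
      using that \<open>n > 0\<close> \<open>n * b \<le> s\<close> False by (intro coeff_Q_op_low F) auto
    then have "(\<Sum>k=2..s + 1. coeff (Q_op n k (s + 1 - k) (F (s + 1 - k) n)) b) = 0"
      by (intro sum.neutral ballI)
    then show ?thesis by (simp only: p_def recursion_rhs_def coeff_minus coeff_sum minus_zero)
  qed
  have "\<exists>d. rational_at_pos d \<and> (\<forall>n>0. (of_nat n * of_nat b - of_nat s) * d n = coeff (p n) b)" for b
    using p p_low False by (intro rational_at_pos_divide_linear rational_poly_at_posD) auto
  then have "\<forall>b. \<exists>d. rational_at_pos d \<and> (\<forall>n>0. (of_nat n * of_nat b - of_nat s) * d n = coeff (p n) b)"
    by blast
  from choice[OF this] obtain d where d: "\<And>b. rational_at_pos (d b)"
    "\<And>b n. n > 0 \<Longrightarrow> (of_nat n * of_nat b - of_nat s) * d b n = coeff (p n) b" by auto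
  obtain B where B: "\<forall>n>0. degree (p n) \<le> B" using rational_poly_at_pos_bound[OF p] ..
  \<comment> \<open>Beyond \<open>B\<close> the right-hand side vanishes, so the coefficients may be
    cut off there.\<close>
  define g where "g n = (\<Sum>b\<le>B. monom (d b n) b)" for n
  have g: "coeff (g n) b = (if b \<le> B then d b n else 0)" for n b
    by (simp add: g_def coeff_sum)
  have "rational_poly_at_pos g"
  proof (rule rational_poly_at_posI)
    show "degree (g n) \<le> B" for n by (rule degree_le) (simp add: g)
    show "rational_at_pos (\<lambda>n. coeff (g n) b)" for b
      unfolding g using d(1) by (cases "b \<le> B") (simp_all add: rational_at_pos_const)
  qed
  moreover have eq: "(of_nat n * of_nat b - of_nat s) * coeff (g n) b = coeff (p n) b" if "n > 0" for n b
  proof (cases "b \<le> B")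
    case True
    then show ?thesis using d(2)[OF that] by (simp add: g)
  next
    case False
    moreover have "degree (p n) \<le> B" using B that by blast
    ultimately show ?thesis by (simp add: g coeff_eq_0)
  qed
  moreover have "coeff (g n) b = 0" if "n > 0" "n * b < s" for n b
  proof -
    have "of_nat n * of_nat b \<noteq> (of_nat s :: rat)"
      using that(2) by (metis less_irrefl of_nat_eq_iff of_nat_mult)
    then show ?thesis using eq[OF that(1), of b] p_low[of n b] that by simp
  qed
  moreover have "smult (of_nat n) ([:0, 1:] * pderiv (g n)) - smult (of_nat s) (g n) = p n" if "n > 0" for n
  proof (rule poly_eqI)
    fix b
    have "coeff ([:0, 1:] * pderiv (g n)) b = of_nat b * coeff (g n) b"
      by (cases b) (simp_all add: coeff_pderiv)
    then show "coeff (smult (of_nat n) ([:0, 1:] * pderiv (g n)) - smult (of_nat s) (g n)) b = coeff (p n) b"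
      using eq[OF that, of b] by (simp add: left_diff_distrib mult.assoc del: mult_pCons_left)
  qed
  ultimately have "recursion_step F s g"
    using False by (simp add: recursion_step_def p_def)
  then show ?thesis by (rule exI[of _ g])
qed

lemma recursion_solution: "\<exists>F. \<forall>s. recursion_step F s (F s)"
proof (rule dependent_wf_choice[of less_than])
  show "recursion_step F s g = recursion_step F' s g" if "\<And>r. (r, s) \<in> less_than \<Longrightarrow> F r = F' r" for F F' s g
  proof -
    have "recursion_rhs F s n = recursion_rhs F' s n" for n
      unfolding recursion_rhs_def using that by (intro arg_cong[of _ _ uminus] sum.cong) auto
    then show ?thesis by (simp add: recursion_step_def)
  qed
  show "\<exists>g. recursion_step F s g" if "\<And>r. (r, s) \<in> less_than \<Longrightarrow> recursion_step F r (F r)" for s F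
    using that by (intro recursion_step_ex) simp
qed simp

section \<open>Normalization at the origin\<close>

interpretation L_poly: rat_hom fps_const "L_series n" for n
  by unfold_locales simp_all

interpretation X_poly: rat_hom fps_const "L_series n ^ n" for n
  by unfold_locales simp_all

lemma poly_fps_L: "poly_fps p (L_series n) = L_poly.ev n p"
  by (simp add: poly_fps_def L_poly.ev_def)

lemma poly_fps_X: "poly_fps p (L_series n ^ n) = X_poly.ev n p"
  by (simp add: poly_fps_def X_poly.ev_def)

lemma X_ev_nth_0: "X_poly.ev n p $ 0 = poly p 1"
  by (induction p) (simp_all add: X_poly.ev_pCons fps_power_zeroth)

lemma L_inverse: "L_series n * inverse (L_series n) = 1"
  by (rule inverse_mult_eq_1') simp

text \<open>This is \<open>L^(1-r) g(L^n)\<close>; the inverse is written out because exponents are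
  natural numbers.\<close>

definition homog :: "nat \<Rightarrow> nat \<Rightarrow> rat poly \<Rightarrow> rat fps" where
  "homog n r g = L_series n * inverse (L_series n) ^ r * X_poly.ev n g"

lemma homog_add: "homog n r (g + h) = homog n r g + homog n r h"
  by (simp add: homog_def X_poly.ev_add algebra_simps)

lemma homog_0 [simp]: "homog n r 0 = 0"
  by (simp add: homog_def)

lemma homog_sum: "homog n r (sum f A) = (\<Sum>a\<in>A. homog n r (f a))"
  by (induction A rule: infinite_finite_induct) (simp_all add: homog_add)

lemma homog_mult: "homog n r (p * g) = X_poly.ev n p * homog n r g"
  by (simp add: homog_def X_poly.ev_mult mult_ac)

lemma D_op_homog:
  assumes "n > 0"
  shows "D_op (homog n r g) = homog n r (T_op n r g)"
proof -
  interpret derivation_algebra fps_const "L_series n ^ n" D_op "L_series n" n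
    by (rule derivation_algebra_fps[OF assms])
  let ?L = "L_series n" and ?X = "L_series n ^ n"
  have ev1: "X_poly.ev n [:-1, 1:] = ?X - 1" by (simp add: X_poly.ev_pCons flip: fps_const_neg)
  define u where "u r = ?L * inverse ?L ^ r" for r
  have u_Suc: "u (Suc r) = u r * inverse ?L" for r by (simp add: u_def mult_ac)
  have Dinv: "D_op (inverse ?L) = - fps_const (1 / of_nat n) * (?X - 1) * inverse ?L"
  proof -
    have "D_op (?L * inverse ?L) = 0" unfolding L_inverse by (simp add: D_op_def)
    then have "?L * D_op (inverse ?L) = - (D_op ?L * inverse ?L)"
      by (simp add: D_mult eq_neg_iff_add_eq_0 add.commute)
    then have "inverse ?L * (?L * D_op (inverse ?L)) = inverse ?L * - (fps_const (1 / of_nat n) * ?L * (?X - 1) * inverse ?L)"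
      unfolding D_y by simp
    then have "(?L * inverse ?L) * D_op (inverse ?L) = (?L * inverse ?L) * (- fps_const (1 / of_nat n) * (?X - 1) * inverse ?L)"
      by (simp only: mult_ac mult_minus_left mult_minus_right)
    then show ?thesis unfolding L_inverse by simp
  qed
  have Du: "D_op (u r) = fps_const ((1 - of_nat r) / of_nat n) * (?X - 1) * u r" for r
  proof (induction r)
    case 0
    show ?case using D_y by (simp add: u_def mult_ac)
  next
    case (Suc r)
    have c: "fps_const ((1 - of_nat (Suc r)) / of_nat n) =
        fps_const ((1 - of_nat r) / of_nat n) - fps_const (1 / of_nat n :: rat)"
      by (simp add: diff_divide_distrib)
    define e a where "e = fps_const (1 / of_nat n :: rat)" and "a = fps_const ((1 - of_nat r) / of_nat n :: rat)"
    show ?case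
      unfolding u_Suc D_mult Suc Dinv c e_def[symmetric] a_def[symmetric] by (simp add: algebra_simps)
  qed
  have "D_op (u r * X_poly.ev n g) = u r * ((?X - 1) * (fps_const ((1 - of_nat r) / of_nat n) * X_poly.ev n g + ?X * X_poly.ev n (pderiv g)))"
    unfolding D_mult Du D_ev by (simp only: algebra_simps)
  also have "\<dots> = u r * X_poly.ev n (T_op n r g)"
    by (simp only: T_op_def X_poly.ev_mult X_poly.ev_add X_poly.ev_smult ev1 X_poly.ev_X)
  finally show ?thesis by (simp add: homog_def u_def)
qed

lemma Lop_homog:
  assumes "n > 0"
  shows "Lop n k (homog n r g) = homog n r (B_op n k r g)"
proof -
  have "(D_op ^^ i) (homog n r g) = homog n r ((T_op n r ^^ i) g)" for i
    by (induction i) (simp_all add: D_op_homog[OF assms])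
  then show ?thesis
    by (simp add: Lop_eq[OF assms] B_op_def homog_sum homog_mult poly_fps_X)
qed

lemma Lop_add: "n > 0 \<Longrightarrow> Lop n k (f + g) = Lop n k f + Lop n k g"
proof -
  assume "n > 0"
  moreover have "(D_op ^^ i) (f + g) = (D_op ^^ i) f + (D_op ^^ i) g" for i
    by (induction i) (simp_all add: D_op_add)
  ultimately show ?thesis by (simp add: Lop_eq distrib_left sum.distrib)
qed

lemma Lop_const_mult: "n > 0 \<Longrightarrow> Lop n k (fps_const c * f) = fps_const c * Lop n k f"
proof -
  assume "n > 0"
  moreover have "(D_op ^^ i) (fps_const c * f) = fps_const c * (D_op ^^ i) f" for i
    by (induction i) (simp_all add: D_op_const_mult)
  ultimately show ?thesis by (simp add: Lop_eq sum_distrib_left mult_ac)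
qed

lemma Lop_sum: "n > 0 \<Longrightarrow> Lop n k (sum f A) = (\<Sum>a\<in>A. Lop n k (f a))"
  by (induction A rule: infinite_finite_induct) (simp_all add: Lop_add)

text \<open>The factor \<open>L^(1-k)\<close> of the summand turns the power
  \<open>L^(1-(s+1-k))\<close> into \<open>L^(1-s)\<close>. All summands thus carry the same power
  of \<open>L\<close>, and an identity of polynomials in \<open>L^n\<close> remains.\<close>

lemma homog_satisfies_ODE:
  assumes n: "n > 0" and F: "\<And>s. recursion_step F s (F s)"
  shows "satisfies_ODE n (\<lambda>s. homog n s (F s n)) s"
proof -
  let ?L = "L_series n"
  define b where "b k = B_op n k (s + 1 - k) (F (s + 1 - k) n)" for k
  have summand: "inverse ?L ^ (k - 1) * Lop n k (if k \<le> s + 1 then homog n (s + 1 - k) (F (s + 1 - k) n) else 0) =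
      (if k \<le> s + 1 then homog n s (b k) else 0)" if "k \<ge> 1" for k
  proof (cases "k \<le> s + 1")
    case True
    then have "inverse ?L ^ s = inverse ?L ^ (k - 1) * inverse ?L ^ (s + 1 - k)"
      using that by (simp flip: power_add)
    then have "inverse ?L ^ (k - 1) * homog n (s + 1 - k) g = homog n s g" for g
      by (simp add: homog_def mult_ac)
    then show ?thesis
      using True by (simp only: Lop_homog[OF n] b_def if_True)
  qed (simp add: n)
  have "(\<Sum>k=1..n. inverse ?L ^ (k - 1) * Lop n k (if k \<le> s + 1 then homog n (s + 1 - k) (F (s + 1 - k) n) else 0)) =
     (\<Sum>k=1..n. if k \<le> s + 1 then homog n s (b k) else 0)"
    by (intro sum.cong refl summand) simp
  \<comment> \<open>The cutoff at \<open>n\<close> is exchanged for the one at \<open>s + 1\<close>,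
    since \<open>b k = 0\<close> for \<open>k > n\<close>.\<close>
  also have "\<dots> = (\<Sum>k=1..n + s + 1. if k \<le> s + 1 then homog n s (b k) else 0)"
    by (intro sum.mono_neutral_left) (auto simp: b_def B_op_eq_0)
  also have "\<dots> = (\<Sum>k=1..s + 1. homog n s (b k))"
    by (intro sum.mono_neutral_cong_right) auto
  also have "\<dots> = homog n s (\<Sum>k=1..s + 1. b k)"
    by (simp only: homog_sum)
  also have "(\<Sum>k=1..s + 1. b k) = b 1 + (\<Sum>k=2..s + 1. b k)"
    by (subst sum.atLeast_Suc_atMost) (simp_all add: numeral_2_eq_2)
  also have "b 1 = [:-1, 1:] * recursion_rhs F s n"
    using F[of s] n B_op_1[OF n, of s "F s n"] by (simp add: b_def recursion_step_def del: mult_pCons_left)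
  also have "(\<Sum>k=2..s + 1. b k) = [:-1, 1:] * (\<Sum>k=2..s + 1. Q_op n k (s + 1 - k) (F (s + 1 - k) n))"
    unfolding sum_distrib_left b_def by (intro sum.cong refl Q_op[symmetric]) auto
  also have "[:-1, 1:] * recursion_rhs F s n + \<dots> = 0"
    unfolding recursion_rhs_def by (simp del: mult_pCons_left)
  finally show ?thesis unfolding satisfies_ODE_def by simp
qed

text \<open>The coefficients of the inverse of the series in \<open>1/w\<close> formed by the values
  at \<open>X = 1\<close>; these are the initial values of the homogeneous solution, as
  \<open>L = 1\<close> at \<open>x = 0\<close>.\<close>

fun norm_coeff :: "(nat \<Rightarrow> nat \<Rightarrow> rat poly) \<Rightarrow> nat \<Rightarrow> nat \<Rightarrow> rat" where
  "norm_coeff F s n = (if s = 0 then 1 else - (\<Sum>q<s. norm_coeff F q n * poly (F (s - q) n) 1))"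

declare norm_coeff.simps [simp del]

lemma rational_at_pos_norm_coeff:
  assumes "\<And>s. rational_poly_at_pos (F s)"
  shows "rational_at_pos (norm_coeff F s)"
proof (induction s rule: less_induct)
  case (less s)
  have "rational_at_pos (\<lambda>n. - (\<Sum>q<s. norm_coeff F q n * poly (F (s - q) n) 1))"
    using less assms
    by (intro rational_at_pos_uminus rational_at_pos_sum rational_at_pos_mult rational_at_pos_poly_eval) auto
  then show ?case
    by (cases "s = 0") (simp_all add: norm_coeff.simps[abs_def] rational_at_pos_const)
qed

definition normalized :: "(nat \<Rightarrow> nat \<Rightarrow> rat poly) \<Rightarrow> nat \<Rightarrow> nat \<Rightarrow> rat fps" where
  "normalized F n s = (\<Sum>q\<le>s. fps_const (norm_coeff F q n) * homog n (s - q) (F (s - q) n))"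

lemma normalized_nth_0:
  assumes "F 0 n = 1"
  shows "normalized F n s $ 0 = (if s = 0 then 1 else 0)"
proof -
  have "homog n r g $ 0 = poly g 1" for r g
    by (simp add: homog_def X_ev_nth_0 fps_power_zeroth)
  then have "normalized F n s $ 0 = (\<Sum>q\<le>s. norm_coeff F q n * poly (F (s - q) n) 1)"
    by (simp add: normalized_def fps_sum_nth)
  also have "\<dots> = (\<Sum>q<s. norm_coeff F q n * poly (F (s - q) n) 1) + norm_coeff F s n"
    by (simp add: lessThan_Suc_atMost[symmetric] assms)
  also have "\<dots> = (if s = 0 then 1 else 0)"
    by (subst (2) norm_coeff.simps) simp
  finally show ?thesis .
qed

text \<open>The system is linear over constants and invariant under shifts of \<open>s\<close>,
  terms of negative index being 0. So it is preserved by multiplication with a series in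
  \<open>1/w\<close> with constant coefficients.\<close>

lemma normalized_satisfies_ODE:
  assumes n: "n > 0" and F: "\<And>s. recursion_step F s (F s)"
  shows "satisfies_ODE n (normalized F n) s"
proof -
  define c where "c q = norm_coeff F q n" for q
  define h where "h s = homog n s (F s n)" for s
  have arg: "(if k \<le> s + 1 then normalized F n (s + 1 - k) else 0) =
     (\<Sum>q\<le>s. fps_const (c q) * (if k \<le> (s - q) + 1 then h ((s - q) + 1 - k) else 0))" if "k \<ge> 1" for k
  proof (cases "k \<le> s + 1")
    case True
    have "normalized F n (s + 1 - k) = (\<Sum>q\<le>s + 1 - k. fps_const (c q) * h (s + 1 - k - q))"
      by (simp add: normalized_def c_def h_def)
    also have "\<dots> = (\<Sum>q\<le>s. fps_const (c q) * (if k \<le> (s - q) + 1 then h ((s - q) + 1 - k) else 0))"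
    proof (rule sum.mono_neutral_cong_left)
      fix q assume "q \<in> {..s + 1 - k}"
      then have "s + 1 - k - q = (s - q) + 1 - k" "k \<le> (s - q) + 1" using True that by auto
      then show "fps_const (c q) * h (s + 1 - k - q) =
          fps_const (c q) * (if k \<le> (s - q) + 1 then h ((s - q) + 1 - k) else 0)" by simp
    qed (use True that in auto)
    finally show ?thesis using True by simp
  next
    case False
    then have "\<not> k \<le> (s - q) + 1" for q by simp
    then show ?thesis using False by simp
  qed
  have "(\<Sum>k=1..n. inverse (L_series n) ^ (k - 1) * Lop n k (if k \<le> s + 1 then normalized F n (s + 1 - k) else 0)) =
    (\<Sum>k=1..n. \<Sum>q\<le>s. fps_const (c q) * (inverse (L_series n) ^ (k - 1) *
        Lop n k (if k \<le> (s - q) + 1 then h ((s - q) + 1 - k) else 0)))"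
    by (intro sum.cong refl)
      (simp only: arg atLeastAtMost_iff Lop_sum[OF n] Lop_const_mult[OF n] sum_distrib_left mult.left_commute)
  also have "\<dots> = (\<Sum>q\<le>s. fps_const (c q) * (\<Sum>k=1..n. inverse (L_series n) ^ (k - 1) *
        Lop n k (if k \<le> (s - q) + 1 then h ((s - q) + 1 - k) else 0)))"
    by (subst sum.swap) (simp only: sum_distrib_left)
  also have "\<dots> = 0"
    using homog_satisfies_ODE[OF n F] unfolding satisfies_ODE_def h_def by simp
  finally show ?thesis unfolding satisfies_ODE_def .
qed

text \<open>Monomials \<open>X^b\<close> with \<open>n b < r\<close> are absent, so
  \<open>L^(-r)\<close> is always absorbed by \<open>L^(n b)\<close>.\<close>

lemma normalized_poly_L:
  assumes low: "\<And>r b. n * b < r \<Longrightarrow> coeff (F r n) b = 0"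
  shows "\<exists>p. normalized F n s = L_series n * poly_fps p (L_series n)"
proof -
  let ?L = "L_series n"
  define u where "u r = (\<Sum>b\<le>degree (F r n). monom (coeff (F r n) b) (n * b - r))" for r
  have u: "inverse ?L ^ r * X_poly.ev n (F r n) = L_poly.ev n (u r)" for r
  proof -
    have "inverse ?L ^ r * (fps_const (coeff (F r n) b) * (?L ^ n) ^ b) = fps_const (coeff (F r n) b) * ?L ^ (n * b - r)" for b
    proof (cases "n * b < r")
      case False
      then have "(?L ^ n) ^ b = ?L ^ r * ?L ^ (n * b - r)" by (simp flip: power_mult power_add)
      then have "inverse ?L ^ r * (fps_const (coeff (F r n) b) * (?L ^ n) ^ b) =
         (?L * inverse ?L) ^ r * (fps_const (coeff (F r n) b) * ?L ^ (n * b - r))"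
        by (simp only: power_mult_distrib mult_ac)
      then show ?thesis by (simp add: L_inverse)
    qed (simp add: low)
    then show ?thesis
      by (simp only: X_poly.ev_altdef[OF order_refl] u_def L_poly.ev_sum L_poly.ev_monom sum_distrib_left)
  qed
  have "normalized F n s = ?L * L_poly.ev n (\<Sum>q\<le>s. smult (norm_coeff F q n) (u (s - q)))"
    by (simp add: normalized_def homog_def mult.assoc u L_poly.ev_sum L_poly.ev_smult sum_distrib_left mult.left_commute)
  then show ?thesis unfolding poly_fps_L by blast
qed

section \<open>Assembling the polynomial in \<open>L\<close>, \<open>1/L\<close> and
  \<open>L^n\<close>\<close>

lemma poly_map_poly_sum_monom:
  fixes f :: "'a::comm_monoid_add \<Rightarrow> 'b::comm_semiring_1"
  assumes "f 0 = 0"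
  shows "poly (map_poly f (\<Sum>b\<le>B. monom (u b) b)) z = (\<Sum>b\<le>B. f (u b) * z ^ b)"
proof -
  have "map_poly f (\<Sum>b\<le>B. monom (u b) b) = (\<Sum>b\<le>B. monom (f (u b)) b)"
    by (rule poly_eqI) (simp add: coeff_map_poly assms coeff_sum)
  then show ?thesis by (simp add: poly_sum poly_monom)
qed

lemma normalized_uniform:
  assumes F: "\<And>s. recursion_step F s (F s)"
  shows "\<exists>\<Psi>. \<forall>n>0. regular3_at (of_nat n) \<Psi> \<and>
     normalized F n s = eval3 \<Psi> (of_nat n) (L_series n) (inverse (L_series n)) (L_series n ^ n)"
proof -
  have rat: "rational_poly_at_pos (F r)" for r using F by (simp add: recursion_step_def)
  have "\<forall>r. \<exists>B. \<forall>n>0. degree (F r n) \<le> B" using rational_poly_at_pos_bound[OF rat] by blast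
  from choice[OF this] obtain B0 where B0: "\<And>r n. n > 0 \<Longrightarrow> degree (F r n) \<le> B0 r" by auto
  define B where "B = (\<Sum>r\<le>s. B0 r)"
  have B: "degree (F r n) \<le> B" if "r \<le> s" "n > 0" for r n
  proof -
    have "B0 r \<le> B" unfolding B_def using that by (intro member_le_sum) auto
    then show ?thesis using B0[OF that(2), of r] by linarith
  qed
  define e where "e r b n = norm_coeff F (s - r) n * coeff (F r n) b" for r b n
  have "rational_at_pos (e r b)" for r b
    unfolding e_def[abs_def]
    by (intro rational_at_pos_mult rational_poly_at_posD rat rational_at_pos_norm_coeff)
  then have "\<forall>r b. \<exists>f::ratfun. \<forall>n>0. regular_at (of_nat n) f \<and> ratfun_eval (of_nat n) f = e r b n"
    using rational_at_pos_imp_ratfun by blast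
  then have "\<exists>\<phi>. \<forall>r b. \<forall>n>0. regular_at (of_nat n) (\<phi> r b :: ratfun) \<and> ratfun_eval (of_nat n) (\<phi> r b) = e r b n"
    by (intro choice allI) (simp add: choice)
  then obtain \<phi> :: "nat \<Rightarrow> nat \<Rightarrow> ratfun" where
    \<phi>: "\<And>r b n. n > 0 \<Longrightarrow> regular_at (of_nat n) (\<phi> r b) \<and> ratfun_eval (of_nat n) (\<phi> r b) = e r b n"
    by blast
  \<comment> \<open>The monomial \<open>X Y^r Z^b\<close> evaluates to
    \<open>L^(1-r) (L^n)^b\<close>; the first variable occurs only to the power 1, from the leading
    \<open>L\<close> in \<open>homog\<close>.\<close>
  define \<Psi> :: ratfun_poly3 where
    "\<Psi> = (\<Sum>b\<le>B. monom (\<Sum>r\<le>s. monom (monom (\<phi> r b) 1) r) b)"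
  have eval0: "ratfun_eval a 0 = 0" for a by (simp add: ratfun_eval_def)
  have "regular3_at (of_nat n) \<Psi>" if "n > 0" for n
  proof -
    have "regular_at (of_nat n) 0" by (simp add: regular_at_def)
    then show ?thesis
      using \<phi>[OF that] by (simp add: regular3_at_def \<Psi>_def coeff_sum)
  qed
  moreover have "normalized F n s = eval3 \<Psi> (of_nat n) (L_series n) (inverse (L_series n)) (L_series n ^ n)"
    if "n > 0" for n
  proof -
    let ?L = "L_series n"
    have "eval3 \<Psi> (of_nat n) ?L (inverse ?L) (?L ^ n) =
       (\<Sum>b\<le>B. (\<Sum>r\<le>s. fps_const (e r b n) * ?L * inverse ?L ^ r) * (?L ^ n) ^ b)"
      unfolding eval3_def \<Psi>_def
      by (subst poly_map_poly_sum_monom, simp, subst poly_map_poly_sum_monom, simp)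
         (simp add: map_poly_monom poly_monom eval0 \<phi>[OF that])
    also have "\<dots> = (\<Sum>r\<le>s. \<Sum>b\<le>B. fps_const (norm_coeff F (s - r) n) *
        (?L * inverse ?L ^ r * (fps_const (coeff (F r n) b) * (?L ^ n) ^ b)))"
      unfolding sum_distrib_right e_def
      by (subst sum.swap) (simp add: fps_const_mult[symmetric] mult_ac del: fps_const_mult)
    also have "\<dots> = (\<Sum>r\<le>s. fps_const (norm_coeff F (s - r) n) * homog n r (F r n))"
      by (intro sum.cong refl) (simp add: homog_def X_poly.ev_altdef[OF B[OF _ that]] sum_distrib_left)
    also have "\<dots> = normalized F n s"
      unfolding normalized_def
      by (rule sum.reindex_bij_witness[of _ "\<lambda>q. s - q" "\<lambda>q. s - q"]) auto
    finally show ?thesis ..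
  qed
  ultimately show ?thesis by blast
qed

theorem theorem4:
  shows "(\<forall>n>0. \<forall>f :: nat \<Rightarrow> rat fps.
            (\<forall>s. satisfies_ODE n f s \<and> fps_nth (f s) 0 = (if s = 0 then 1 else 0))
              \<longleftrightarrow> (\<forall>s. f s = Phi n s)) \<and>
         (\<forall>n>0. \<forall>s. \<exists>p :: rat poly. Phi n s = L_series n * poly_fps p (L_series n)) \<and>
         (\<forall>s. \<exists>\<Psi> :: ratfun_poly3. \<forall>n>0.
            regular3_at (of_nat n) \<Psi> \<and>
            Phi n s = eval3 \<Psi> (of_nat n) (L_series n) (inverse (L_series n)) (L_series n ^ n))"
proof -
  \<comment> \<open>One family serves all \<open>n\<close>, which gives a single
    \<open>\<Psi>\<close> for each \<open>s\<close>.\<close>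
  obtain F where F: "\<And>s. recursion_step F s (F s)" using recursion_solution by blast
  have F0: "F 0 n = 1" for n using F[of 0] by (simp add: recursion_step_def)
  have sol: "ode_solution n (normalized F n)" if "n > 0" for n
    using that normalized_satisfies_ODE[OF that F] normalized_nth_0[where F = F and n = n, OF F0] by (simp add: ode_solution_def)
  have Phi: "Phi n s = normalized F n s" if "n > 0" for n s
    using ode_solution.Phi_eq[OF sol[OF that]] .
  have "(\<forall>s. satisfies_ODE n f s \<and> f s $ 0 = (if s = 0 then 1 else 0)) \<longleftrightarrow> (\<forall>s. f s = Phi n s)"
    if n: "n > 0" for n f
  proof
    assume "\<forall>s. satisfies_ODE n f s \<and> f s $ 0 = (if s = 0 then 1 else 0)"
    then have "ode_solution n f" using n by (simp add: ode_solution_def)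
    then show "\<forall>s. f s = Phi n s" using ode_solution.Phi_eq by metis
  next
    assume "\<forall>s. f s = Phi n s"
    then have "f = normalized F n" using Phi[OF n] by auto
    then show "\<forall>s. satisfies_ODE n f s \<and> f s $ 0 = (if s = 0 then 1 else 0)"
      using sol[OF n] by (simp add: ode_solution_def)
  qed
  moreover have "\<exists>p. Phi n s = L_series n * poly_fps p (L_series n)" if "n > 0" for n s
    unfolding Phi[OF that] using F that by (intro normalized_poly_L) (simp add: recursion_step_def)
  moreover have "\<exists>\<Psi>. \<forall>n>0. regular3_at (of_nat n) \<Psi> \<and>
            Phi n s = eval3 \<Psi> (of_nat n) (L_series n) (inverse (L_series n)) (L_series n ^ n)" for s
    using normalized_uniform[OF F, of s] by (simp add: Phi)
  ultimately show ?thesis by blast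
qed

end
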